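(* Suppose that: (i) the observed index set $\Omega\subseteq[n]$ is drawn by the Bernoulli model with probability $p$ (each index in $[n]$ is included independently with probability $p$); (ii) the rank-$r$ Hankel matrix $\mathcal{H}\mathbf{x}^\natural=\mathcal{G}\mathbf{z}^\natural$ is $\mu$-incoherent, i.e., $\|\mathbf{U}^\natural\|_{2,\infty}\le\sqrt{\mu c_s r/n}$ and $\|\mathbf{V}^\natural\|_{2,\infty}\le\sqrt{\mu c_s r/n}$, where $\mathbf{U}^\natural\mathbf{\Sigma}^\natural\mathbf{V}^{\natural *}$ is its compact SVD and $c_s=\max\{n/n_1,n/n_2\}$; (iii) the observed outliers are $\alpha p$-sparse, $\|\Pi_\Omega\mathbf{s}^\natural\|_0\le\alpha p n$. Assume $p\ge(\varepsilon_0^{-2}\kappa^3c_s\mu r^2\log n)/n$ and $\alpha\le1/(32c_s\mu r\kappa)$, where $\varepsilon_0\in(0,\frac{\sqrt{\kappa r}}{8c_0})$ with some constant $c_0$. Then with probability at least $1-2n^{-2}$, the initialization step of HSGD satisfies $$d_0\le 26\alpha c_s\kappa\mu r\sqrt{r}\sqrt{\sigma_r^\natural}+7c_0\varepsilon_0\sqrt{\sigma_r^\natural/\kappa}.$$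
   Context: Setting: $\mathcal{H}$ is the Hankel mapping $\mathbb{C}^n\to\mathbb{C}^{n_1\times n_2}$, $[\mathcal{H}\mathbf{x}]_{i,j}=x_{i+j-1}$, $n=n_1+n_2-1$; $[\mathcal{D}\mathbf{x}]_i=\sqrt{\varsigma_i}x_i$ with $\varsigma_i$ the number of entries on the $i$-th antidiagonal; $\mathcal{G}=\mathcal{H}\mathcal{D}^{-1}$. $\mathbf{f}=\mathbf{z}^\natural+\mathbf{s}^\natural$ ($\mathbf{z}^\natural=\mathcal{D}\mathbf{x}^\natural$ low-rank Hankel part, $\mathbf{s}^\natural$ reweighted outliers) and only $\Pi_\Omega\mathbf{f}$ is observed ($\Pi_\Omega$ zeroes entries outside $\Omega$). $\sigma_i^\natural$ are singular values of $\mathcal{H}\mathbf{x}^\natural$, $\kappa=\sigma_1^\natural/\sigma_r^\natural$. HSGD initialization: $\mathbf{s}^{(0)}=\mathcal{D}\Gamma_{\alpha p}(\mathcal{D}^{-1}\Pi_\Omega\mathbf{f})$ where $\Gamma_{\tilde\alpha}$ keeps the $\tilde\alpha n$ largest-magnitude entries; $\mathbf{U}^{(0)}\mathbf{\Sigma}^{(0)}\mathbf{V}^{(0)*}$ is the rank-$r$ truncated SVD of $p^{-1}\mathcal{G}(\Pi_\Omega\mathbf{f}-\mathbf{s}^{(0)})$; $\tilde{\mathbf{L}}^{(0)}=\mathbf{U}^{(0)}(\mathbf{\Sigma}^{(0)})^{1/2}$, $\tilde{\mathbf{R}}^{(0)}=\mathbf{V}^{(0)}(\mathbf{\Sigma}^{(0)})^{1/2}$;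 $\mathbf{L}^{(0)}=\Pi_{\mathcal{L}}\tilde{\mathbf{L}}^{(0)}$, $\mathbf{R}^{(0)}=\Pi_{\mathcal{R}}\tilde{\mathbf{R}}^{(0)}$ with $\mathcal{L}=\{\mathbf{L}:\|\mathbf{L}\|_{2,\infty}^2\le\frac{2\mu rc_s}{n}\|\tilde{\mathbf{L}}^{(0)}\|_2^2\}$, $\mathcal{R}=\{\mathbf{R}:\|\mathbf{R}\|_{2,\infty}^2\le\frac{2\mu rc_s}{n}\|\tilde{\mathbf{R}}^{(0)}\|_2^2\}$. $d_0=\min_{\mathbf{Q}}\sqrt{\|\mathbf{L}^{(0)}-\mathbf{L}^\natural\mathbf{Q}\|_F^2+\|\mathbf{R}^{(0)}-\mathbf{R}^\natural\mathbf{Q}\|_F^2}$ over $r\times r$ rotation matrices $\mathbf{Q}$, with $\mathbf{L}^\natural=\mathbf{U}^\natural\mathbf{\Sigma}^{\natural1/2}$, $\mathbf{R}^\natural=\mathbf{V}^\natural\mathbf{\Sigma}^{\natural1/2}$. *)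

theory Defs
  imports "HOL-Probability.Probability"
begin

text \<open>Conventions. Indices are 0-based: a vector in C^n is a function nat => complex whose
entries at 0..n-1 matter; an a x b matrix is a function nat => nat => complex whose entries
(i,j) with i < a, j < b matter. All notions below only inspect entries inside these ranges.\<close>

type_synonym cvec = "nat \<Rightarrow> complex"
type_synonym cmat = "nat \<Rightarrow> nat \<Rightarrow> complex"

text \<open>Hankel mapping: [H x]_{i,j} = x_{i+j} (0-based version of x_{i+j-1}).\<close>
definition hankel :: "cvec \<Rightarrow> cmat" where
  "hankel x = (\<lambda>i j. x (i + j))"

definition varsigma :: "nat \<Rightarrow> nat \<Rightarrow> nat \<Rightarrow> nat" where
  "varsigma n1 n2 k = card {(i, j). i < n1 \<and> j < n2 \<and> i + j = k}"

definition Dop :: "nat \<Rightarrow> nat \<Rightarrow> cvec \<Rightarrow> cvec" where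
  "Dop n1 n2 x = (\<lambda>k. complex_of_real (sqrt (real (varsigma n1 n2 k))) * x k)"

definition Dinv :: "nat \<Rightarrow> nat \<Rightarrow> cvec \<Rightarrow> cvec" where
  "Dinv n1 n2 z = (\<lambda>k. z k / complex_of_real (sqrt (real (varsigma n1 n2 k))))"

definition Gop :: "nat \<Rightarrow> nat \<Rightarrow> cvec \<Rightarrow> cmat" where
  "Gop n1 n2 z = hankel (Dinv n1 n2 z)"

definition PiOm :: "nat set \<Rightarrow> cvec \<Rightarrow> cvec" where
  "PiOm \<Omega> f = (\<lambda>i. if i \<in> \<Omega> then f i else 0)"

definition l0 :: "nat \<Rightarrow> cvec \<Rightarrow> nat" where
  "l0 n v = card {i. i < n \<and> v i \<noteq> 0}"

definition bernoulli_set_pmf :: "nat \<Rightarrow> real \<Rightarrow> nat set pmf" where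
  "bernoulli_set_pmf n p = map_pmf (\<lambda>b. {i. b i}) (Pi_pmf {..<n} False (\<lambda>_. bernoulli_pmf p))"

definition orthonormal_cols :: "nat \<Rightarrow> nat \<Rightarrow> cmat \<Rightarrow> bool" where
  "orthonormal_cols n r U \<longleftrightarrow>
     (\<forall>a<r. \<forall>b<r. (\<Sum>i<n. cnj (U i a) * U i b) = (if a = b then 1 else 0))"

definition unitary_mat :: "nat \<Rightarrow> cmat \<Rightarrow> bool" where
  "unitary_mat r Q \<longleftrightarrow> orthonormal_cols r r Q"

definition matmul :: "nat \<Rightarrow> cmat \<Rightarrow> cmat \<Rightarrow> cmat" where
  "matmul m A B = (\<lambda>i j. \<Sum>k<m. A i k * B k j)"

definition fro :: "nat \<Rightarrow> nat \<Rightarrow> cmat \<Rightarrow> real" where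
  "fro a b A = sqrt (\<Sum>i<a. \<Sum>j<b. (cmod (A i j))\<^sup>2)"

definition spec_norm :: "nat \<Rightarrow> nat \<Rightarrow> cmat \<Rightarrow> real" where
  "spec_norm a b A = Sup {sqrt (\<Sum>i<a. (cmod (\<Sum>j<b. A i j * v j))\<^sup>2) | v.
                           (\<Sum>j<b. (cmod (v j))\<^sup>2) \<le> 1}"

definition norm2inf :: "nat \<Rightarrow> nat \<Rightarrow> cmat \<Rightarrow> real" where
  "norm2inf a b L = Max (insert 0 ((\<lambda>i. sqrt (\<Sum>j<b. (cmod (L i j))\<^sup>2)) ` {..<a}))"

definition is_svd :: "nat \<Rightarrow> nat \<Rightarrow> cmat \<Rightarrow> cmat \<Rightarrow> (nat \<Rightarrow> real) \<Rightarrow> cmat \<Rightarrow> bool" where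
  "is_svd n1 n2 M U s V \<longleftrightarrow>
     (let k = min n1 n2 in
       orthonormal_cols n1 k U \<and> orthonormal_cols n2 k V \<and>
       (\<forall>l<k. 0 \<le> s l) \<and> (\<forall>l m. l \<le> m \<and> m < k \<longrightarrow> s m \<le> s l) \<and>
       (\<forall>i<n1. \<forall>j<n2. M i j = (\<Sum>l<k. U i l * complex_of_real (s l) * cnj (V j l))))"

definition is_trunc_svd :: "nat \<Rightarrow> nat \<Rightarrow> nat \<Rightarrow> cmat \<Rightarrow> cmat \<Rightarrow> (nat \<Rightarrow> real) \<Rightarrow> cmat \<Rightarrow> bool" where
  "is_trunc_svd n1 n2 r M U s V \<longleftrightarrow> r \<le> min n1 n2 \<and>
     (\<exists>U' s' V'. is_svd n1 n2 M U' s' V' \<and>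
        (\<forall>i<n1. \<forall>l<r. U i l = U' i l) \<and> (\<forall>j<n2. \<forall>l<r. V j l = V' j l) \<and>
        (\<forall>l<r. s l = s' l))"

definition is_compact_svd :: "nat \<Rightarrow> nat \<Rightarrow> nat \<Rightarrow> cmat \<Rightarrow> cmat \<Rightarrow> (nat \<Rightarrow> real) \<Rightarrow> cmat \<Rightarrow> bool" where
  "is_compact_svd n1 n2 r M U s V \<longleftrightarrow>
     orthonormal_cols n1 r U \<and> orthonormal_cols n2 r V \<and>
     (\<forall>l<r. 0 < s l) \<and> (\<forall>l m. l \<le> m \<and> m < r \<longrightarrow> s m \<le> s l) \<and>
     (\<forall>i<n1. \<forall>j<n2. M i j = (\<Sum>l<r. U i l * complex_of_real (s l) * cnj (V j l)))"

definition half_factor :: "cmat \<Rightarrow> (nat \<Rightarrow> real) \<Rightarrow> cmat" where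
  "half_factor U s = (\<lambda>i l. U i l * complex_of_real (sqrt (s l)))"

definition is_proj_rowball :: "nat \<Rightarrow> nat \<Rightarrow> real \<Rightarrow> cmat \<Rightarrow> cmat \<Rightarrow> bool" where
  "is_proj_rowball a b B Lt L \<longleftrightarrow>
     (norm2inf a b L)\<^sup>2 \<le> B \<and>
     (\<forall>L'. (norm2inf a b L')\<^sup>2 \<le> B \<longrightarrow>
            fro a b (\<lambda>i j. L i j - Lt i j) \<le> fro a b (\<lambda>i j. L' i j - Lt i j))"

definition is_Gamma :: "nat \<Rightarrow> nat \<Rightarrow> cvec \<Rightarrow> cvec \<Rightarrow> bool" where
  "is_Gamma n k y w \<longleftrightarrow>
     (\<exists>T. T \<subseteq> {..<n} \<and> card T = min k n \<and>
          (\<forall>i\<in>T. \<forall>j\<in>{..<n} - T. cmod (y j) \<le> cmod (y i)) \<and>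
          (\<forall>i<n. w i = (if i \<in> T then y i else 0)))"

definition dist_factors :: "nat \<Rightarrow> nat \<Rightarrow> nat \<Rightarrow> cmat \<Rightarrow> cmat \<Rightarrow> cmat \<Rightarrow> cmat \<Rightarrow> real" where
  "dist_factors n1 n2 r L R Lnat Rnat =
     Inf {sqrt ((fro n1 r (\<lambda>i j. L i j - matmul r Lnat Q i j))\<^sup>2 +
                (fro n2 r (\<lambda>i j. R i j - matmul r Rnat Q i j))\<^sup>2) | Q. unitary_mat r Q}"

end

theory Submission
  imports Defs
begin

text \<open>Write \<open>M = H x\<close> and \<open>M0\<close> for the matrix whose truncated singular value decomposition is taken. Both
  \<open>M0 - M\<close> and its two constituents, the sampling noise and the thresholding error, are Hankel, so their
  operator norms are at most the largest discrete Fourier coefficient of their symbols. This replaces the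
  matrix Bernstein inequality by a scalar exponential-moment bound and a union over \<open>n\<close> frequencies; the
  variance loses only a factor 2, because the first row and the last column of \<open>M\<close> contain every entry of \<open>x\<close>.
  The thresholding error has at most \<open>2 \<alpha> p n\<close> nonzero entries, each of size at most twice the largest
  entry of \<open>x\<close>, divided by \<open>p\<close>. From the operator norm one passes to the Frobenius error of the rank-\<open>r\<close>
  truncation and, by balancedness, to the distance of the aligned factors; projecting onto the row-norm
  balls does not increase it.\<close>

section \<open>Vectors, orthonormal columns and operator bounds\<close>

text \<open>All randomness is confined to one event: every Fourier coefficient of the sampling noise
  is at most 2 \<tau>. On it the argument is deterministic, so the bound holds simultaneously for
  every admissible thresholding, truncated decomposition and projection, however ties are broken.
  The sparsity of the observed outliers is a property of the same sample and therefore stands inside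
  the event as a premise. The obstacle is that the radii of the row-norm balls are computed from the
  estimate itself. Projection is harmless only if the aligned true factors lie in these balls, so
  the top singular value of \<open>M0\<close> must be at least half that of \<open>M\<close>. This
  is what the smallness of \<alpha> and \<epsilon>0 provides, in the form
  \<open>d \<le> \<sigma> 0 / 2\<close>. The unitary that aligns the factors is taken as the polar
  factor of their cross-Gram matrix. This makes that matrix positive semidefinite, and the distance
  of the factors is then compared with the distance of the products through r x r Gram matrices
  alone.\<close>

definition vnorm :: "nat \<Rightarrow> cvec \<Rightarrow> real" where
  "vnorm n v = sqrt (\<Sum>i<n. (cmod (v i))\<^sup>2)"

definition cdot :: "nat \<Rightarrow> cvec \<Rightarrow> cvec \<Rightarrow> complex" where
  "cdot n u v = (\<Sum>i<n. cnj (u i) * v i)"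

definition col :: "cmat \<Rightarrow> nat \<Rightarrow> cvec" where
  "col U l = (\<lambda>i. U i l)"

definition mvec :: "nat \<Rightarrow> cmat \<Rightarrow> cvec \<Rightarrow> cvec" where
  "mvec b A v = (\<lambda>i. \<Sum>j<b. A i j * v j)"

lemma vnorm_nonneg [simp]: "0 \<le> vnorm n v"
  by (simp add: vnorm_def sum_nonneg)

lemma vnorm_sq: "(vnorm n v)\<^sup>2 = (\<Sum>i<n. (cmod (v i))\<^sup>2)"
  by (simp add: vnorm_def sum_nonneg)

lemma vnorm_cong: "(\<And>i. i < n \<Longrightarrow> u i = v i) \<Longrightarrow> vnorm n u = vnorm n v"
  by (simp add: vnorm_def)

lemma vnorm_L2_set: "vnorm n v = L2_set (\<lambda>i. cmod (v i)) {..<n}"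
  by (simp add: vnorm_def L2_set_def)

lemma vnorm_cnj [simp]: "vnorm n (\<lambda>i. cnj (v i)) = vnorm n v"
  by (simp add: vnorm_def)

lemma vnorm_uminus [simp]: "vnorm n (\<lambda>i. - v i) = vnorm n v"
  by (simp add: vnorm_def)

lemma vnorm_scale: "vnorm n (\<lambda>i. c * v i) = cmod c * vnorm n v"
  by (simp add: vnorm_L2_set norm_mult L2_set_right_distrib)

lemma vnorm_triangle: "vnorm n (\<lambda>i. u i + v i) \<le> vnorm n u + vnorm n v"
proof -
  have "vnorm n (\<lambda>i. u i + v i) \<le> L2_set (\<lambda>i. cmod (u i) + cmod (v i)) {..<n}"
    unfolding vnorm_L2_set by (rule L2_set_mono) (auto intro: norm_triangle_ineq)
  also have "\<dots> \<le> vnorm n u + vnorm n v"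
    unfolding vnorm_L2_set by (rule L2_set_triangle_ineq)
  finally show ?thesis .
qed

lemma vnorm_triangle_diff: "vnorm n (\<lambda>i. u i - v i) \<le> vnorm n u + vnorm n v"
  using vnorm_triangle[of n u "\<lambda>i. - v i"] by simp

lemma vnorm_eq_0_iff: "vnorm n v = 0 \<longleftrightarrow> (\<forall>i<n. v i = 0)"
  by (auto simp: vnorm_L2_set L2_set_eq_0_iff)

lemma sum_cmod_mult_le: "(\<Sum>i<n. cmod (u i) * cmod (v i)) \<le> vnorm n u * vnorm n v"
  using L2_set_mult_ineq[of "\<lambda>i. cmod (u i)" "\<lambda>i. cmod (v i)" "{..<n}"]
  by (simp add: vnorm_L2_set)

lemma cmod_sum_mult_le: "cmod (\<Sum>i<n. u i * v i) \<le> vnorm n u * vnorm n v"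
proof -
  have "cmod (\<Sum>i<n. u i * v i) \<le> (\<Sum>i<n. cmod (u i) * cmod (v i))"
    by (rule sum_norm_le) (simp add: norm_mult)
  also note sum_cmod_mult_le
  finally show ?thesis .
qed

lemma cdot_self: "cdot n v v = of_real ((vnorm n v)\<^sup>2)"
  by (simp add: cdot_def vnorm_sq complex_norm_square mult.commute del: of_real_power)

lemma cnj_cdot: "cnj (cdot n u v) = cdot n v u"
  by (simp add: cdot_def mult.commute)

lemma cdot_diff_left: "cdot n (\<lambda>i. u i - u' i) v = cdot n u v - cdot n u' v"
  by (simp add: cdot_def algebra_simps sum_subtractf)

lemma cdot_diff_right: "cdot n u (\<lambda>i. v i - v' i) = cdot n u v - cdot n u v'"
  by (simp add: cdot_def algebra_simps sum_subtractf)

lemma cdot_scale_left: "cdot n (\<lambda>i. c * u i) v = cnj c * cdot n u v"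
  by (simp add: cdot_def algebra_simps sum_distrib_left)

lemma cdot_scale_right: "cdot n u (\<lambda>i. c * v i) = c * cdot n u v"
  by (simp add: cdot_def algebra_simps sum_distrib_left)

lemma cdot_add_right: "cdot n u (\<lambda>i. v i + v' i) = cdot n u v + cdot n u v'"
  by (simp add: cdot_def algebra_simps sum.distrib)

lemma cdot_cong:
  "(\<And>i. i < n \<Longrightarrow> u i = u' i) \<Longrightarrow> (\<And>i. i < n \<Longrightarrow> v i = v' i) \<Longrightarrow> cdot n u v = cdot n u' v'"
  by (simp add: cdot_def)

lemma cdot_mvec_right: "cdot n u (mvec k A c) = (\<Sum>l<k. cdot n u (col A l) * c l)"
  unfolding cdot_def mvec_def col_def sum_distrib_left sum_distrib_right
  by (subst sum.swap) (simp add: mult_ac)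

lemma cdot_mvec_left: "cdot n (mvec k A c) v = (\<Sum>l<k. cnj (c l) * cdot n (col A l) v)"
  unfolding cdot_def mvec_def col_def sum_distrib_left sum_distrib_right cnj_sum
  by (subst sum.swap) (simp add: mult_ac)

lemma vnorm_diff_sq:
  "(vnorm n (\<lambda>i. u i - v i))\<^sup>2 = (vnorm n u)\<^sup>2 + (vnorm n v)\<^sup>2 - 2 * Re (cdot n u v)"
proof -
  have "complex_of_real ((vnorm n (\<lambda>i. u i - v i))\<^sup>2)
      = of_real ((vnorm n u)\<^sup>2) + of_real ((vnorm n v)\<^sup>2) - (cdot n u v + cnj (cdot n u v))"
    unfolding cdot_self[symmetric] cnj_cdot by (simp add: cdot_diff_left cdot_diff_right)
  also have "cdot n u v + cnj (cdot n u v) = of_real (2 * Re (cdot n u v))"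
    by (rule complex_add_cnj)
  finally show ?thesis unfolding of_real_add[symmetric] of_real_diff[symmetric] of_real_eq_iff .
qed

lemma orthonormal_cols_cdot:
  "orthonormal_cols n k U \<Longrightarrow> a < k \<Longrightarrow> b < k \<Longrightarrow> cdot n (col U a) (col U b) = (if a = b then 1 else 0)"
  by (simp add: orthonormal_cols_def cdot_def col_def)

lemma orthonormal_cols_mono: "orthonormal_cols n k U \<Longrightarrow> m \<le> k \<Longrightarrow> orthonormal_cols n m U"
  by (simp add: orthonormal_cols_def)

lemma orthonormal_cols_cong:
  "orthonormal_cols n k U \<Longrightarrow> (\<And>i l. i < n \<Longrightarrow> l < k \<Longrightarrow> U i l = U' i l) \<Longrightarrow> orthonormal_cols n k U'"
  by (simp add: orthonormal_cols_def)

lemma vnorm_col: "orthonormal_cols n k U \<Longrightarrow> l < k \<Longrightarrow> vnorm n (col U l) = 1"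
proof -
  assume "orthonormal_cols n k U" "l < k"
  then have "complex_of_real ((vnorm n (col U l))\<^sup>2) = of_real 1"
    unfolding cdot_self[symmetric] by (simp add: orthonormal_cols_cdot)
  then have "(vnorm n (col U l))\<^sup>2 = 1\<^sup>2" unfolding of_real_eq_iff by simp
  then show ?thesis by (rule power2_eq_imp_eq) simp_all
qed

lemma cdot_col_mvec:
  assumes "orthonormal_cols n k U" "l < k"
  shows "cdot n (col U l) (mvec k U c) = c l"
proof -
  have "cdot n (col U l) (mvec k U c) = (\<Sum>m<k. if m = l then c m else 0)"
    unfolding cdot_mvec_right
    by (rule sum.cong) (use assms in \<open>auto simp: orthonormal_cols_cdot\<close>)
  with assms(2) show ?thesis by simp
qed

lemma vnorm_mvec_orthonormal:
  assumes "orthonormal_cols n k U"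
  shows "vnorm n (mvec k U c) = vnorm k c"
proof -
  have "cdot n (mvec k U c) (mvec k U c) = (\<Sum>l<k. cnj (c l) * c l)"
    unfolding cdot_mvec_left[of n k U c "mvec k U c"]
    by (rule sum.cong) (simp_all add: cdot_col_mvec[OF assms])
  then have "complex_of_real ((vnorm n (mvec k U c))\<^sup>2) = of_real ((vnorm k c)\<^sup>2)"
    unfolding cdot_self[symmetric] cdot_def[of k] .
  then show ?thesis unfolding of_real_eq_iff by simp
qed

text \<open>Pythagoras: \<open>mvec k U c\<close> is the orthogonal projection of \<open>v\<close>
  onto the column span, and its norm is that of its coefficient vector. Bessel's inequality and the
  contractivity of the complementary projection are both read off from this identity.\<close>

lemma vnorm_residual:
  fixes v :: cvec
  assumes "orthonormal_cols n k U"
  defines "c \<equiv> \<lambda>l. cdot n (col U l) v"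
  shows "(vnorm n (\<lambda>i. v i - mvec k U c i))\<^sup>2 = (vnorm n v)\<^sup>2 - (vnorm k c)\<^sup>2"
proof -
  have "cdot n (mvec k U c) v = (\<Sum>l<k. cnj (c l) * c l)"
    by (simp add: cdot_mvec_left c_def)
  also have "\<dots> = of_real ((vnorm k c)\<^sup>2)"
    unfolding cdot_self[symmetric] cdot_def ..
  finally have "Re (cdot n v (mvec k U c)) = (vnorm k c)\<^sup>2"
    using cnj_cdot[of n "mvec k U c" v] by (metis Re_complex_of_real complex_cnj_complex_of_real)
  then show ?thesis
    by (simp add: vnorm_diff_sq vnorm_mvec_orthonormal[OF assms(1)])
qed

lemma bessel:
  assumes "orthonormal_cols n k U"
  shows "vnorm k (\<lambda>l. cdot n (col U l) v) \<le> vnorm n v"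
proof -
  have "(vnorm k (\<lambda>l. cdot n (col U l) v))\<^sup>2 \<le> (vnorm n v)\<^sup>2"
    using vnorm_residual[OF assms, of v]
      zero_le_power2[of "vnorm n (\<lambda>i. v i - mvec k U (\<lambda>l. cdot n (col U l) v) i)"] by linarith
  then show ?thesis by simp
qed

lemma vnorm_residual_le:
  assumes "orthonormal_cols n k U"
  shows "vnorm n (\<lambda>i. v i - mvec k U (\<lambda>l. cdot n (col U l) v) i) \<le> vnorm n v"
proof -
  have "(vnorm n (\<lambda>i. v i - mvec k U (\<lambda>l. cdot n (col U l) v) i))\<^sup>2 \<le> (vnorm n v)\<^sup>2"
    using vnorm_residual[OF assms, of v] by simp
  then show ?thesis by simp
qed

text \<open>Elimination by induction on the equations: a nonzero coefficient of the new equation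
  solves for one unknown, and the remaining equations stay fewer than the remaining unknowns. This
  is the dimension count that produces a kernel vector for the singular value inequality.\<close>

lemma homogeneous_system:
  fixes a :: "'i \<Rightarrow> 'j \<Rightarrow> 'f::field"
  assumes "finite I" "finite J" "card I < card J"
  shows "\<exists>c. (\<exists>j\<in>J. c j \<noteq> 0) \<and> (\<forall>i\<in>I. (\<Sum>j\<in>J. a i j * c j) = 0)"
  using assms
proof (induction I arbitrary: J a rule: finite_induct)
  case empty
  then obtain j where "j \<in> J" by fastforce
  then show ?case by (intro exI[of _ "\<lambda>_. 1"]) auto
next
  case (insert i I)
  show ?case
  proof (cases "\<forall>j\<in>J. a i j = 0")
    case True
    from insert have "card I < card J" by simp
    from insert.IH[OF insert.prems(1) this, of a] obtain c where
      "\<exists>j\<in>J. c j \<noteq> 0" "\<forall>i\<in>I. (\<Sum>j\<in>J. a i j * c j) = 0" by blast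
    with True show ?thesis by (intro exI[of _ c]) simp
  next
    case False
    then obtain j0 where j0: "j0 \<in> J" "a i j0 \<noteq> 0" by blast
    \<comment> \<open>The system after subtracting from every row the multiple of row
      \<open>i\<close> that cancels column \<open>j0\<close>.\<close>
    define b where "b = (\<lambda>i' j. a i' j - a i' j0 * a i j / a i j0)"
    from insert j0 have "card I < card (J - {j0})" by simp
    from insert.IH[OF _ this, of b] insert.prems obtain c where
      c: "\<exists>j\<in>J-{j0}. c j \<noteq> 0" "\<And>i'. i' \<in> I \<Longrightarrow> (\<Sum>j\<in>J-{j0}. b i' j * c j) = 0"
      by auto
    define S where "S = (\<Sum>j\<in>J-{j0}. a i j * c j)"
    define c' where "c' = c(j0 := - S / a i j0)"
    have split: "(\<Sum>j\<in>J. a k j * c' j) = (\<Sum>j\<in>J-{j0}. a k j * c j) - a k j0 * S / a i j0" for k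
    proof -
      have "(\<Sum>j\<in>J. a k j * c' j) = a k j0 * c' j0 + (\<Sum>j\<in>J-{j0}. a k j * c' j)"
        using insert.prems(1) j0(1) by (rule sum.remove)
      also have "(\<Sum>j\<in>J-{j0}. a k j * c' j) = (\<Sum>j\<in>J-{j0}. a k j * c j)"
        by (rule sum.cong) (auto simp: c'_def)
      finally show ?thesis by (simp add: c'_def)
    qed
    have "(\<Sum>j\<in>J. a i' j * c' j) = 0" if "i' \<in> I" for i'
    proof -
      have "(\<Sum>j\<in>J-{j0}. b i' j * c j) = (\<Sum>j\<in>J-{j0}. a i' j * c j) - a i' j0 / a i j0 * S"
        unfolding b_def S_def sum_distrib_left sum_subtractf[symmetric]
        by (rule sum.cong) (auto simp: algebra_simps)
      with c(2)[OF that] split show ?thesis by simp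
    qed
    moreover have "(\<Sum>j\<in>J. a i j * c' j) = 0"
      using split[of i] j0(2) by (simp add: S_def)
    moreover have "\<exists>j\<in>J. c' j \<noteq> 0"
      using c(1) by (auto simp: c'_def)
    ultimately show ?thesis by (intro exI[of _ c']) auto
  qed
qed

text \<open>An upper bound on the operator norm, stated through the sesquilinear form instead of a
  supremum: such bounds add directly, Hankel sums can be estimated in exactly this form, and
  suitable test vectors give norm bounds for both the matrix and its adjoint.\<close>

definition op_le :: "nat \<Rightarrow> nat \<Rightarrow> cmat \<Rightarrow> real \<Rightarrow> bool" where
  "op_le a b A d \<longleftrightarrow> 0 \<le> d \<and> (\<forall>u v. cmod (cdot a u (mvec b A v)) \<le> d * vnorm a u * vnorm b v)"

lemma op_leI:
  "0 \<le> d \<Longrightarrow> (\<And>u v. cmod (cdot a u (mvec b A v)) \<le> d * vnorm a u * vnorm b v) \<Longrightarrow> op_le a b A d"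
  by (simp add: op_le_def)

lemma op_le_vnorm_mvec:
  assumes "op_le a b A d"
  shows "vnorm a (mvec b A v) \<le> d * vnorm b v"
proof -
  let ?w = "mvec b A v"
  have "(vnorm a ?w)\<^sup>2 = cmod (cdot a ?w ?w)"
    by (simp add: cdot_self del: of_real_power)
  also have "\<dots> \<le> d * vnorm a ?w * vnorm b v"
    using assms by (simp add: op_le_def)
  finally have "vnorm a ?w * vnorm a ?w \<le> vnorm a ?w * (d * vnorm b v)"
    by (simp add: power2_eq_square mult_ac)
  moreover have "0 \<le> d * vnorm b v" using assms by (simp add: op_le_def)
  ultimately show ?thesis
    by (cases "vnorm a ?w = 0") (auto simp: mult_le_cancel_left)
qed

text \<open>The vector is the row \<open>u\<^sup>* A\<close>; testing the form with its conjugate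
  turns the form into a squared norm. It serves where an error is tested against left singular
  vectors.\<close>

lemma op_le_vnorm_adjoint:
  assumes "op_le a b A d"
  shows "vnorm b (\<lambda>j. cdot a u (col A j)) \<le> d * vnorm a u"
proof -
  let ?w = "\<lambda>j. cdot a u (col A j)"
  let ?v = "\<lambda>j. cnj (?w j)"
  have "(vnorm b ?w)\<^sup>2 = cmod (\<Sum>j<b. ?w j * ?v j)"
    using cdot_self[of b ?v] by (simp add: cdot_def[of b] del: of_real_power)
  also have "\<dots> = cmod (cdot a u (mvec b A ?v))"
    by (simp add: cdot_mvec_right)
  also have "\<dots> \<le> d * vnorm a u * vnorm b ?v"
    using assms unfolding op_le_def by blast
  finally have "vnorm b ?w * vnorm b ?w \<le> vnorm b ?w * (d * vnorm a u)"
    by (simp add: power2_eq_square mult_ac)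
  moreover have "0 \<le> d * vnorm a u" using assms by (simp add: op_le_def)
  ultimately show ?thesis
    by (cases "vnorm b ?w = 0") (auto simp: mult_le_cancel_left)
qed

lemma op_le_add:
  assumes "op_le a b A d" "op_le a b B e"
  shows "op_le a b (\<lambda>i j. A i j + B i j) (d + e)"
proof (rule op_leI)
  show "0 \<le> d + e" using assms by (simp add: op_le_def)
  fix u v
  have "mvec b (\<lambda>i j. A i j + B i j) v = (\<lambda>i. mvec b A v i + mvec b B v i)"
    by (simp add: mvec_def algebra_simps sum.distrib)
  then have "cmod (cdot a u (mvec b (\<lambda>i j. A i j + B i j) v))
      \<le> cmod (cdot a u (mvec b A v)) + cmod (cdot a u (mvec b B v))"
    by (simp add: cdot_add_right norm_triangle_ineq)
  also have "\<dots> \<le> d * vnorm a u * vnorm b v + e * vnorm a u * vnorm b v"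
    using assms by (intro add_mono) (simp_all add: op_le_def)
  finally show "cmod (cdot a u (mvec b (\<lambda>i j. A i j + B i j) v)) \<le> (d + e) * vnorm a u * vnorm b v"
    by (simp add: algebra_simps)
qed

lemma op_le_mono:
  assumes "op_le a b A d" "d \<le> e"
  shows "op_le a b A e"
proof (rule op_leI)
  show "0 \<le> e" using assms by (simp add: op_le_def)
  fix u v
  have "cmod (cdot a u (mvec b A v)) \<le> d * vnorm a u * vnorm b v"
    using assms by (simp add: op_le_def)
  also have "\<dots> \<le> e * vnorm a u * vnorm b v"
    using assms by (intro mult_right_mono) auto
  finally show "cmod (cdot a u (mvec b A v)) \<le> e * vnorm a u * vnorm b v" .
qed

lemma op_le_cong: "op_le a b A d \<Longrightarrow> (\<And>i j. i < a \<Longrightarrow> j < b \<Longrightarrow> A i j = B i j) \<Longrightarrow> op_le a b B d"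
  by (simp add: op_le_def cdot_def mvec_def)

section \<open>Perturbation of a truncated singular value decomposition\<close>

lemma vnorm_mono: "(\<And>i. i < n \<Longrightarrow> cmod (u i) \<le> cmod (v i)) \<Longrightarrow> vnorm n u \<le> vnorm n v"
  unfolding vnorm_L2_set by (rule L2_set_mono) auto

lemma mvec_svd:
  assumes "\<forall>i<n1. \<forall>j<n2. M i j = (\<Sum>l<k. U i l * of_real (s l) * cnj (V j l))" "i < n1"
  shows "mvec n2 M v i = mvec k U (\<lambda>l. of_real (s l) * cdot n2 (col V l) v) i"
proof -
  have "mvec n2 M v i = (\<Sum>j<n2. (\<Sum>l<k. U i l * of_real (s l) * cnj (V j l)) * v j)"
    unfolding mvec_def using assms by simp
  also have "\<dots> = mvec k U (\<lambda>l. of_real (s l) * cdot n2 (col V l) v) i"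
    unfolding mvec_def cdot_def col_def sum_distrib_left sum_distrib_right
    by (subst sum.swap) (simp add: mult_ac)
  finally show ?thesis .
qed

text \<open>Idea: some nonzero combination of the
  first \<open>r + 1\<close> right singular vectors of \<open>M0\<close> lies in the kernel of \<open>M\<close>.\<close>

lemma weyl_tail:
  assumes svd0: "\<forall>i<n1. \<forall>j<n2. M0 i j = (\<Sum>l<k. U' i l * of_real (s' l) * cnj (V' j l))"
    and U': "orthonormal_cols n1 k U'" and V': "orthonormal_cols n2 k V'"
    and nonneg: "\<forall>l<k. 0 \<le> s' l" and decr: "\<forall>l m. l \<le> m \<and> m < k \<longrightarrow> s' m \<le> s' l"
    and svd: "\<forall>i<n1. \<forall>j<n2. M i j = (\<Sum>l<r. U i l * of_real (\<sigma> l) * cnj (V j l))"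
    and diff: "op_le n1 n2 (\<lambda>i j. M0 i j - M i j) d"
    and "r < k"
  shows "s' r \<le> d"
proof -
  obtain c where c: "\<exists>j\<in>{..r}. c j \<noteq> 0"
    "\<And>i. i < r \<Longrightarrow> (\<Sum>j\<le>r. cdot n2 (col V i) (col V' j) * c j) = 0"
    using homogeneous_system[of "{..<r}" "{..r}" "\<lambda>i j. cdot n2 (col V i) (col V' j)"] by auto
  define c' where "c' = (\<lambda>l. if l \<le> r then c l else 0)"
  define v where "v = mvec k V' c'"
  have cV: "cdot n2 (col V i) v = 0" if "i < r" for i
  proof -
    have "cdot n2 (col V i) v = (\<Sum>j<k. if j \<in> {..r} then cdot n2 (col V i) (col V' j) * c j else 0)"
      unfolding v_def cdot_mvec_right by (rule sum.cong) (auto simp: c'_def)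
    also have "\<dots> = (\<Sum>j\<in>{..<k} \<inter> {..r}. cdot n2 (col V i) (col V' j) * c j)"
      by (rule sum.inter_restrict[symmetric]) simp
    also have "{..<k} \<inter> {..r} = {..r}" using \<open>r < k\<close> by auto
    finally show ?thesis using c(2)[OF that] by simp
  qed
  have cV': "cdot n2 (col V' l) v = c' l" if "l < k" for l
    unfolding v_def using cdot_col_mvec[OF V' that] .
  have vn: "vnorm n2 v = vnorm k c'"
    unfolding v_def using vnorm_mvec_orthonormal[OF V'] .
  have "\<exists>l<k. c' l \<noteq> 0"
    using c(1) \<open>r < k\<close> by (auto simp: c'_def)
  then have "vnorm k c' \<noteq> 0"
    unfolding vnorm_eq_0_iff by blast
  then have pos: "vnorm k c' > 0"
    using vnorm_nonneg[of k c'] by linarith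
  \<comment> \<open>On the span of the first r + 1 right singular vectors \<open>M0\<close>
    stretches by at least \<open>s' r\<close>, while \<open>M0 v = (M0 - M) v\<close>, whose norm is
    at most d times that of \<open>v\<close>.\<close>
  have "s' r * vnorm k c' = vnorm k (\<lambda>l. of_real (s' r) * c' l)"
    using nonneg \<open>r < k\<close> by (simp add: vnorm_scale)
  also have "\<dots> \<le> vnorm k (\<lambda>l. of_real (s' l) * cdot n2 (col V' l) v)"
    using nonneg decr \<open>r < k\<close>
    by (intro vnorm_mono) (auto simp: cV' norm_mult c'_def mult_right_mono)
  also have "\<dots> = vnorm n1 (mvec k U' (\<lambda>l. of_real (s' l) * cdot n2 (col V' l) v))"
    by (rule vnorm_mvec_orthonormal[OF U', symmetric])
  also have "\<dots> = vnorm n1 (mvec n2 (\<lambda>i j. M0 i j - M i j) v)"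
  proof (rule vnorm_cong)
    fix i assume i: "i < n1"
    have "mvec n2 M v i = 0"
      unfolding mvec_svd[OF svd i] by (simp add: mvec_def cV)
    moreover have "mvec n2 (\<lambda>i j. M0 i j - M i j) v i = mvec n2 M0 v i - mvec n2 M v i"
      by (simp add: mvec_def algebra_simps sum_subtractf)
    ultimately show "mvec k U' (\<lambda>l. of_real (s' l) * cdot n2 (col V' l) v) i
        = mvec n2 (\<lambda>i j. M0 i j - M i j) v i"
      using mvec_svd[OF svd0 i] by simp
  qed
  also have "\<dots> \<le> d * vnorm k c'"
    using op_le_vnorm_mvec[OF diff, of v] by (simp add: vn)
  finally show ?thesis using pos by simp
qed

text \<open>Test with the top right singular vector of \<open>M\<close>: its image under
  \<open>M\<close> has norm \<open>\<sigma> 0\<close>, its image under \<open>M0\<close> at most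
  \<open>s' 0\<close>. Later this bounds from below the radii of the row-norm balls, which depend on
  the estimate.\<close>

lemma weyl_top:
  assumes svd0: "\<forall>i<n1. \<forall>j<n2. M0 i j = (\<Sum>l<k. U' i l * of_real (s' l) * cnj (V' j l))"
    and U': "orthonormal_cols n1 k U'" and V': "orthonormal_cols n2 k V'"
    and nonneg: "\<forall>l<k. 0 \<le> s' l" and decr: "\<forall>l m. l \<le> m \<and> m < k \<longrightarrow> s' m \<le> s' l"
    and svd: "\<forall>i<n1. \<forall>j<n2. M i j = (\<Sum>l<r. U i l * of_real (\<sigma> l) * cnj (V j l))"
    and U: "orthonormal_cols n1 r U" and V: "orthonormal_cols n2 r V"
    and diff: "op_le n1 n2 (\<lambda>i j. M0 i j - M i j) d"
    and "0 < r" "0 < k" "0 \<le> \<sigma> 0"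
  shows "\<sigma> 0 \<le> s' 0 + d"
proof -
  let ?v = "col V 0"
  have M: "mvec n2 M ?v i = \<sigma> 0 * col U 0 i" if "i < n1" for i
  proof -
    have "mvec n2 M ?v i = (\<Sum>l<r. if l = 0 then U i l * of_real (\<sigma> l) else 0)"
      unfolding mvec_svd[OF svd that] unfolding mvec_def
      by (rule sum.cong) (use \<open>0 < r\<close> in \<open>auto simp: orthonormal_cols_cdot[OF V]\<close>)
    with \<open>0 < r\<close> show ?thesis by (simp add: col_def)
  qed
  have "\<sigma> 0 = vnorm n1 (\<lambda>i. \<sigma> 0 * col U 0 i)"
    using assms by (simp add: vnorm_scale vnorm_col[OF U])
  also have "\<dots> = vnorm n1 (\<lambda>i. mvec k U' (\<lambda>l. of_real (s' l) * cdot n2 (col V' l) ?v) i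
      - mvec n2 (\<lambda>i j. M0 i j - M i j) ?v i)"
  proof (rule vnorm_cong)
    fix i assume i: "i < n1"
    have "mvec n2 (\<lambda>i j. M0 i j - M i j) ?v i = mvec n2 M0 ?v i - mvec n2 M ?v i"
      by (simp add: mvec_def algebra_simps sum_subtractf)
    then show "\<sigma> 0 * col U 0 i = mvec k U' (\<lambda>l. of_real (s' l) * cdot n2 (col V' l) ?v) i
      - mvec n2 (\<lambda>i j. M0 i j - M i j) ?v i"
      using mvec_svd[OF svd0 i, of ?v] M[OF i] by simp
  qed
  also have "\<dots> \<le> vnorm n1 (mvec k U' (\<lambda>l. of_real (s' l) * cdot n2 (col V' l) ?v))
      + vnorm n1 (mvec n2 (\<lambda>i j. M0 i j - M i j) ?v)"
    by (rule vnorm_triangle_diff)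
  also have "vnorm n1 (mvec n2 (\<lambda>i j. M0 i j - M i j) ?v) \<le> d"
    using op_le_vnorm_mvec[OF diff, of ?v] vnorm_col[OF V \<open>0 < r\<close>] by simp
  also have "vnorm n1 (mvec k U' (\<lambda>l. of_real (s' l) * cdot n2 (col V' l) ?v))
      = vnorm k (\<lambda>l. of_real (s' l) * cdot n2 (col V' l) ?v)"
    by (rule vnorm_mvec_orthonormal[OF U'])
  also have "\<dots> \<le> vnorm k (\<lambda>l. of_real (s' 0) * cdot n2 (col V' l) ?v)"
    using nonneg decr \<open>0 < k\<close> by (intro vnorm_mono) (auto simp: norm_mult intro!: mult_right_mono)
  also have "\<dots> \<le> s' 0"
    using nonneg \<open>0 < k\<close> bessel[OF V', of ?v] vnorm_col[OF V \<open>0 < r\<close>]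
    by (simp add: vnorm_scale mult_left_le)
  finally show ?thesis by simp
qed

section \<open>Projection onto the orthogonal complement of the leading left singular
  vectors\<close>

definition residual :: "nat \<Rightarrow> nat \<Rightarrow> cmat \<Rightarrow> cvec \<Rightarrow> cvec" where
  "residual n r U v = (\<lambda>i. v i - mvec r U (\<lambda>l. cdot n (col U l) v) i)"

lemma residual_diff: "residual n r U (\<lambda>i. u i - v i) i = residual n r U u i - residual n r U v i"
  by (simp add: residual_def mvec_def cdot_diff_right algebra_simps sum_subtractf)

lemma residual_cong:
  "(\<And>i. i < n \<Longrightarrow> u i = v i) \<Longrightarrow> i < n \<Longrightarrow> residual n r U u i = residual n r U v i"
  by (simp add: residual_def cdot_def)

lemma residual_sum: "residual n r U (\<lambda>i. \<Sum>m\<in>A. w m i * c m) i = (\<Sum>m\<in>A. residual n r U (w m) i * c m)"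
proof -
  have "cdot n (col U l) (\<lambda>i. \<Sum>m\<in>A. w m i * c m) = (\<Sum>m\<in>A. cdot n (col U l) (w m) * c m)" for l
    unfolding cdot_def sum_distrib_left sum_distrib_right by (subst sum.swap) (simp add: mult_ac)
  then have "mvec r U (\<lambda>l. cdot n (col U l) (\<lambda>i. \<Sum>m\<in>A. w m i * c m)) i
      = (\<Sum>m\<in>A. mvec r U (\<lambda>l. cdot n (col U l) (w m)) i * c m)"
    unfolding mvec_def by (simp add: sum_distrib_left sum_distrib_right, subst sum.swap) (simp add: mult_ac)
  then show ?thesis
    by (simp add: residual_def left_diff_distrib sum_subtractf)
qed

lemma residual_mvec:
  assumes "orthonormal_cols n k U" "r \<le> k"
  shows "residual n r U (mvec k U g) i = mvec k U (\<lambda>l. if l < r then 0 else g l) i"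
proof -
  have "mvec r U (\<lambda>l. cdot n (col U l) (mvec k U g)) i = (\<Sum>l<r. U i l * g l)"
    unfolding mvec_def[of r] by (rule sum.cong) (use assms in \<open>auto simp: cdot_col_mvec\<close>)
  also have "\<dots> = (\<Sum>l\<in>{..<k} \<inter> {..<r}. U i l * g l)"
    using assms by (intro sum.cong) auto
  also have "\<dots> = (\<Sum>l<k. if l \<in> {..<r} then U i l * g l else 0)"
    by (rule sum.inter_restrict) simp
  finally show ?thesis
    unfolding residual_def by (simp add: mvec_def flip: sum_subtractf) (auto intro!: sum.cong)
qed

lemma pythagoras_residual:
  assumes "orthonormal_cols n r U"
  shows "(vnorm n v)\<^sup>2 = (vnorm r (\<lambda>l. cdot n (col U l) v))\<^sup>2 + (vnorm n (residual n r U v))\<^sup>2"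
  using vnorm_residual[OF assms, of v] by (simp add: residual_def)

text \<open>The projection deletes the first r terms of the decomposition of \<open>M0\<close>; the
  surviving coefficients carry singular values at most d, and Bessel's inequality bounds the
  rest.\<close>

lemma vnorm_residual_svd_le:
  assumes svd0: "\<forall>i<n1. \<forall>j<n2. M0 i j = (\<Sum>l<k. U' i l * of_real (s' l) * cnj (V' j l))"
    and U': "orthonormal_cols n1 k U'" and V': "orthonormal_cols n2 k V'"
    and "r \<le> k" and "0 \<le> d" and tail: "\<And>l. r \<le> l \<Longrightarrow> l < k \<Longrightarrow> \<bar>s' l\<bar> \<le> d"
  shows "vnorm n1 (residual n1 r U' (mvec n2 M0 v)) \<le> d * vnorm n2 v"
proof -
  let ?g = "\<lambda>l. of_real (s' l) * cdot n2 (col V' l) v"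
  have "vnorm n1 (residual n1 r U' (mvec n2 M0 v)) = vnorm n1 (mvec k U' (\<lambda>l. if l < r then 0 else ?g l))"
  proof (rule vnorm_cong)
    fix i assume "i < n1"
    then have "residual n1 r U' (mvec n2 M0 v) i = residual n1 r U' (mvec k U' ?g) i"
      by (intro residual_cong mvec_svd[OF svd0])
    then show "residual n1 r U' (mvec n2 M0 v) i = mvec k U' (\<lambda>l. if l < r then 0 else ?g l) i"
      by (simp add: residual_mvec[OF U' \<open>r \<le> k\<close>])
  qed
  also have "\<dots> = vnorm k (\<lambda>l. if l < r then 0 else ?g l)"
    by (rule vnorm_mvec_orthonormal[OF U'])
  also have "\<dots> \<le> vnorm k (\<lambda>l. of_real d * cdot n2 (col V' l) v)"
    using tail \<open>0 \<le> d\<close> by (intro vnorm_mono) (auto simp: norm_mult intro!: mult_right_mono)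
  also have "\<dots> = d * vnorm k (\<lambda>l. cdot n2 (col V' l) v)"
    using \<open>0 \<le> d\<close> by (simp add: vnorm_scale)
  also have "\<dots> \<le> d * vnorm n2 v"
    using bessel[OF V'] \<open>0 \<le> d\<close> by (intro mult_left_mono)
  finally show ?thesis .
qed

text \<open>Splitting along the left singular space of \<open>M0\<close>: the component inside is that of \<open>M0 - M\<close>,
  the component outside is that of \<open>- M\<close>, which acts on the \<open>r\<close> right singular vectors of \<open>M\<close> only.\<close>

lemma truncation_error_frobenius:
  assumes svd0: "\<forall>i<n1. \<forall>j<n2. M0 i j = (\<Sum>l<k. U' i l * of_real (s' l) * cnj (V' j l))"
    and U': "orthonormal_cols n1 k U'" and V': "orthonormal_cols n2 k V'"
    and nonneg: "\<forall>l<k. 0 \<le> s' l" and decr: "\<forall>l m. l \<le> m \<and> m < k \<longrightarrow> s' m \<le> s' l"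
    and svd: "\<forall>i<n1. \<forall>j<n2. M i j = (\<Sum>l<r. U i l * of_real (\<sigma> l) * cnj (V j l))"
    and V: "orthonormal_cols n2 r V"
    and diff: "op_le n1 n2 (\<lambda>i j. M0 i j - M i j) d" and "r \<le> k"
  shows "(\<Sum>i<n1. \<Sum>j<n2. (cmod ((\<Sum>l<r. U' i l * of_real (s' l) * cnj (V' j l)) - M i j))\<^sup>2)
           \<le> 5 * real r * d\<^sup>2"
proof -
  define T where "T = (\<lambda>i j. \<Sum>l<r. U' i l * of_real (s' l) * cnj (V' j l))"
  define X where "X = (\<lambda>i j. T i j - M i j)"
  define \<Delta> where "\<Delta> = (\<lambda>i j. M0 i j - M i j)"
  have U'r: "orthonormal_cols n1 r U'" using orthonormal_cols_mono[OF U' \<open>r \<le> k\<close>] .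
  have d: "0 \<le> d" using diff by (simp add: op_le_def)
  have tail: "\<bar>s' l\<bar> \<le> d" if "r \<le> l" "l < k" for l
  proof -
    have "s' l \<le> s' r" using decr that by simp
    also have "s' r \<le> d"
      using weyl_tail[OF svd0 U' V' nonneg decr svd diff] that by simp
    finally show ?thesis using nonneg that by simp
  qed
  have colT: "col T j = mvec r U' (\<lambda>l. of_real (s' l) * cnj (V' j l))" for j
    by (simp add: fun_eq_iff col_def T_def mvec_def mult_ac)
  have colX: "col X j = (\<lambda>i. col T j i - col M j i)" for j
    by (simp add: X_def col_def)
  have inside: "(\<Sum>j<n2. (vnorm r (\<lambda>l. cdot n1 (col U' l) (col X j)))\<^sup>2) \<le> real r * d\<^sup>2"
  proof -
    \<comment> \<open>\<open>T\<close> and \<open>M0\<close> have the same components along the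
      first r left singular vectors, so there the truncation error is tested exactly as
      \<open>M0 - M\<close>.\<close>
    have eq: "cdot n1 (col U' l) (col X j) = cdot n1 (col U' l) (col \<Delta> j)" if "l < r" "j < n2" for l j
    proof -
      have "cdot n1 (col U' l) (col M0 j)
          = cdot n1 (col U' l) (mvec k U' (\<lambda>l. of_real (s' l) * cnj (V' j l)))"
        using svd0 that by (intro cdot_cong) (simp_all add: col_def mvec_def mult_ac)
      also have "\<dots> = of_real (s' l) * cnj (V' j l)"
        using that \<open>r \<le> k\<close> by (intro cdot_col_mvec[OF U']) simp
      also have "\<dots> = cdot n1 (col U' l) (col T j)"
        unfolding colT using cdot_col_mvec[OF U'r that(1)] by simp
      finally have "cdot n1 (col U' l) (col M0 j) = cdot n1 (col U' l) (col T j)" .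
      moreover have "col \<Delta> j = (\<lambda>i. col M0 j i - col M j i)"
        by (simp add: \<Delta>_def col_def)
      ultimately show ?thesis by (simp add: colX cdot_diff_right)
    qed
    have "(\<Sum>j<n2. (vnorm r (\<lambda>l. cdot n1 (col U' l) (col X j)))\<^sup>2)
        = (\<Sum>l<r. (vnorm n2 (\<lambda>j. cdot n1 (col U' l) (col \<Delta> j)))\<^sup>2)"
      unfolding vnorm_sq by (subst sum.swap) (simp add: eq)
    also have "\<dots> \<le> (\<Sum>l<r. d\<^sup>2)"
    proof (rule sum_mono)
      fix l assume "l \<in> {..<r}"
      then have "vnorm n2 (\<lambda>j. cdot n1 (col U' l) (col \<Delta> j)) \<le> d"
        using op_le_vnorm_adjoint[OF diff, of "col U' l"] vnorm_col[OF U'r, of l]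
        by (simp add: \<Delta>_def)
      then show "(vnorm n2 (\<lambda>j. cdot n1 (col U' l) (col \<Delta> j)))\<^sup>2 \<le> d\<^sup>2"
        by (intro power_mono) auto
    qed
    finally show ?thesis by simp
  qed
  define y where "y = (\<lambda>m. residual n1 r U' (mvec n2 M (col V m)))"
  \<comment> \<open>Write \<open>M = M0 - \<Delta>\<close>. After projection the first term is at
    most d because only tail singular values remain, the second because of the perturbation bound;
    hence 2 d, and 4 after squaring.\<close>
  have y_le: "(vnorm n1 (y m))\<^sup>2 \<le> 4 * d\<^sup>2" if "m < r" for m
  proof -
    have "vnorm n1 (y m) = vnorm n1 (\<lambda>i. residual n1 r U' (mvec n2 M0 (col V m)) i
        - residual n1 r U' (mvec n2 \<Delta> (col V m)) i)"
      unfolding y_def residual_diff[symmetric]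
      by (simp add: \<Delta>_def mvec_def left_diff_distrib sum_subtractf)
    also have "\<dots> \<le> vnorm n1 (residual n1 r U' (mvec n2 M0 (col V m)))
        + vnorm n1 (residual n1 r U' (mvec n2 \<Delta> (col V m)))"
      by (rule vnorm_triangle_diff)
    also have "\<dots> \<le> d + d"
    proof (rule add_mono)
      show "vnorm n1 (residual n1 r U' (mvec n2 M0 (col V m))) \<le> d"
        using vnorm_residual_svd_le[OF svd0 U' V' \<open>r \<le> k\<close> d tail, of "col V m"] vnorm_col[OF V that]
        by simp
      show "vnorm n1 (residual n1 r U' (mvec n2 \<Delta> (col V m))) \<le> d"
        using vnorm_residual_le[OF U'r, of "mvec n2 \<Delta> (col V m)"]
          op_le_vnorm_mvec[OF diff, of "col V m"] vnorm_col[OF V that]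
        by (simp add: residual_def \<Delta>_def)
    qed
    finally have "(vnorm n1 (y m))\<^sup>2 \<le> (2 * d)\<^sup>2" by (intro power_mono) auto
    then show ?thesis by (simp add: power_mult_distrib)
  qed
  have res_X: "residual n1 r U' (col X j) i = - (\<Sum>m<r. y m i * cnj (V j m))" if "i < n1" "j < n2" for i j
  proof -
    have "residual n1 r U' (col T j) i = 0"
      unfolding colT residual_mvec[OF U'r order_refl] by (simp add: mvec_def)
    moreover have "residual n1 r U' (col M j) i
        = residual n1 r U' (\<lambda>i. \<Sum>m<r. mvec n2 M (col V m) i * cnj (V j m)) i"
    proof (rule residual_cong)
      fix i assume i: "i < n1"
      have "mvec n2 M (col V m) i = U i m * of_real (\<sigma> m)" if "m < r" for m
      proof -
        have "mvec n2 M (col V m) i = (\<Sum>l<r. if l = m then U i l * of_real (\<sigma> l) else 0)"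
          unfolding mvec_svd[OF svd i] unfolding mvec_def
          by (rule sum.cong) (use that in \<open>auto simp: orthonormal_cols_cdot[OF V]\<close>)
        with that show ?thesis by simp
      qed
      with svd i that(2) show "col M j i = (\<Sum>m<r. mvec n2 M (col V m) i * cnj (V j m))"
        by (simp add: col_def)
    qed fact
    ultimately show ?thesis
      by (simp add: colX residual_diff residual_sum y_def)
  qed
  \<comment> \<open>Each row of the residual is, up to sign and conjugation, a combination of the r
    orthonormal right singular vectors of \<open>M\<close>. Its Frobenius mass is thus carried by
    the r vectors \<open>y m\<close> rather than by n2 columns, which is where the factor r comes
    from.\<close>
  have "(\<Sum>j<n2. (vnorm n1 (residual n1 r U' (col X j)))\<^sup>2)
      = (\<Sum>i<n1. (vnorm n2 (mvec r V (\<lambda>m. cnj (y m i))))\<^sup>2)"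
    unfolding vnorm_sq
  proof (subst sum.swap, intro sum.cong refl)
    fix i j assume "i \<in> {..<n1}" "j \<in> {..<n2}"
    then have "residual n1 r U' (col X j) i = - cnj (mvec r V (\<lambda>m. cnj (y m i)) j)"
      by (simp add: res_X mvec_def mult_ac)
    then show "(cmod (residual n1 r U' (col X j) i))\<^sup>2 = (cmod (mvec r V (\<lambda>m. cnj (y m i)) j))\<^sup>2"
      by simp
  qed
  also have "\<dots> = (\<Sum>m<r. (vnorm n1 (y m))\<^sup>2)"
    unfolding vnorm_mvec_orthonormal[OF V] unfolding vnorm_sq by (subst sum.swap) simp
  also have "\<dots> \<le> (\<Sum>m<r. 4 * d\<^sup>2)"
    by (rule sum_mono) (use y_le in auto)
  finally have outside: "(\<Sum>j<n2. (vnorm n1 (residual n1 r U' (col X j)))\<^sup>2) \<le> real r * (4 * d\<^sup>2)"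
    by simp
  have "(\<Sum>i<n1. \<Sum>j<n2. (cmod (X i j))\<^sup>2) = (\<Sum>j<n2. (vnorm n1 (col X j))\<^sup>2)"
    unfolding vnorm_sq col_def by (rule sum.swap)
  also have "\<dots> = (\<Sum>j<n2. (vnorm r (\<lambda>l. cdot n1 (col U' l) (col X j)))\<^sup>2)
      + (\<Sum>j<n2. (vnorm n1 (residual n1 r U' (col X j)))\<^sup>2)"
    unfolding sum.distrib[symmetric] by (intro sum.cong refl pythagoras_residual[OF U'r])
  also have "\<dots> \<le> real r * d\<^sup>2 + real r * (4 * d\<^sup>2)"
    using inside outside by (rule add_mono)
  finally show ?thesis by (simp add: X_def T_def)
qed

section \<open>Procrustes alignment of balanced factors\<close>

text \<open>Tychonoff for function types. Matrices are functions on all pairs of naturals, so the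
  search for an extremal unitary takes place in an infinite product.\<close>

lemma compact_Pi_UNIV:
  fixes S :: "'i \<Rightarrow> 'a::topological_space set"
  assumes "\<And>i. compact (S i)"
  shows "compact (Pi UNIV S)"
proof -
  have "compactin (product_topology (\<lambda>i. euclidean) UNIV) (PiE UNIV S)"
    using assms by (simp add: compactin_PiE)
  then show ?thesis
    by (simp add: euclidean_product_topology PiE_UNIV_domain)
qed

lemma cmod_orthonormal_entry_le:
  assumes "orthonormal_cols n k U" "i < n" "l < k"
  shows "cmod (U i l) \<le> 1"
proof -
  have "cmod (col U l i) \<le> vnorm n (col U l)"
    unfolding vnorm_L2_set using assms by (intro member_le_L2_set) auto
  then show ?thesis using vnorm_col[OF assms(1,3)] by (simp add: col_def)
qed

lemma continuous_on_entry: "continuous_on S (\<lambda>Q::cmat. Q i j)"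
  by (rule continuous_on_subset[OF _ subset_UNIV])
     (intro continuous_on_product_then_coordinatewise[OF continuous_on_product_coordinates])

text \<open>Unitarity constrains only the entries with both indices below r. Requiring every entry
  to lie in the unit disc also confines the remaining ones, and this gives compactness.\<close>

lemma compact_unitary: "compact {Q. Q \<in> Pi UNIV (\<lambda>_. Pi UNIV (\<lambda>_. cball 0 1)) \<and> unitary_mat r Q}"
proof -
  have "closed {Q. unitary_mat r Q}"
    unfolding unitary_mat_def orthonormal_cols_def
    by (intro closed_Collect_all closed_Collect_imp open_Collect_const closed_Collect_eq)
       (auto intro!: continuous_intros continuous_on_entry)
  moreover have "compact (Pi UNIV (\<lambda>_. Pi UNIV (\<lambda>_. cball (0::complex) 1)) :: cmat set)"
    by (intro compact_Pi_UNIV) auto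
  ultimately show ?thesis
    unfolding Collect_conj_eq by (simp add: compact_Int_closed)
qed

text \<open>Multiplying \<open>Q\<close> by the unitary \<open>I + (\<zeta> - 1) v v\<^sup>*\<close> with \<open>\<zeta>\<close> on the unit circle.\<close>

lemma unitary_rank_one_update:
  assumes Q: "unitary_mat r Q" and v: "vnorm r v = 1" and \<zeta>: "cmod \<zeta> = 1"
  defines "q \<equiv> mvec r Q v"
  shows "unitary_mat r (\<lambda>i b. Q i b + (\<zeta> - 1) * q i * cnj (v b))"
proof -
  let ?c = "\<lambda>b. (\<zeta> - 1) * cnj (v b)"
  have Q': "orthonormal_cols r r Q" using Q by (simp add: unitary_mat_def)
  have qq: "cdot r q q = 1"
    using v by (simp add: cdot_self q_def vnorm_mvec_orthonormal[OF Q'])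
  have Qq: "cdot r (col Q b) q = v b" if "b < r" for b
    unfolding q_def using cdot_col_mvec[OF Q' that] .
  have qQ: "cdot r q (col Q b) = cnj (v b)" if "b < r" for b
    using Qq[OF that] cnj_cdot[of r "col Q b" q] by simp
  have zz: "\<zeta> * cnj \<zeta> = 1"
    using \<zeta> complex_norm_square[of \<zeta>] by simp
  have "cdot r (\<lambda>i. col Q a i + ?c a * q i) (\<lambda>i. col Q b i + ?c b * q i) = (if a = b then 1 else 0)"
    if ab: "a < r" "b < r" for a b
  proof -
    have "cdot r (\<lambda>i. col Q a i + ?c a * q i) (\<lambda>i. col Q b i + ?c b * q i)
       = cdot r (col Q a) (col Q b) + ?c b * cdot r (col Q a) q + cnj (?c a) * cdot r q (col Q b)
         + cnj (?c a) * ?c b * cdot r q q"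
      unfolding cdot_def sum_distrib_left sum.distrib[symmetric]
      by (rule sum.cong) (simp_all add: algebra_simps)
    also have "\<dots> = (if a = b then 1 else 0) + v a * cnj (v b) * (\<zeta> * cnj \<zeta> - 1)"
      by (simp add: orthonormal_cols_cdot[OF Q'] ab Qq qQ qq algebra_simps)
    finally show ?thesis by (simp add: zz)
  qed
  then show ?thesis
    by (simp add: unitary_mat_def orthonormal_cols_def cdot_def col_def mult_ac)
qed

text \<open>The unitary factor of a polar decomposition, obtained as a maximiser of \<open>Re (tr (Q\<^sup>* A))\<close>:
  no rank-one update may increase the trace, which forces \<open>v\<^sup>* Q\<^sup>* A v \<ge> 0\<close>.\<close>

lemma polar_unitary:
  shows "\<exists>Q. unitary_mat r Q \<and> (\<forall>v. \<exists>h\<ge>0. cdot r (mvec r Q v) (mvec r A v) = complex_of_real h)"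
proof -
  define K where "K = {Q. Q \<in> Pi UNIV (\<lambda>_. Pi UNIV (\<lambda>_. cball 0 1)) \<and> unitary_mat r Q}"
  define f where "f = (\<lambda>Q. Re (\<Sum>b<r. cdot r (col Q b) (col A b)))"
  have "(\<Sum>i<r. cnj (if i = a then 1 else 0) * (if i = b then 1 else 0)) = (if a = b then 1 else (0::complex))"
    if "a < r" for a b
  proof -
    have "(\<Sum>i<r. cnj (if i = a then 1 else 0) * (if i = b then 1 else 0))
        = (\<Sum>i<r. if i = a then (if a = b then 1 else (0::complex)) else 0)"
      by (rule sum.cong) auto
    with that show ?thesis by simp
  qed
  then have "(\<lambda>i j. if i = j then 1 else 0) \<in> K"
    by (simp add: K_def unitary_mat_def orthonormal_cols_def)
  then have "K \<noteq> {}" by blast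
  moreover have "continuous_on K f"
    unfolding f_def cdot_def col_def by (intro continuous_intros continuous_on_entry)
  ultimately obtain Q where Q: "Q \<in> K" and max: "\<And>Q'. Q' \<in> K \<Longrightarrow> f Q' \<le> f Q"
    using continuous_attains_sup[of K f] compact_unitary[of r] unfolding K_def by blast
  have U: "unitary_mat r Q" using Q by (simp add: K_def)
  have unit: "\<exists>h\<ge>0. cdot r (mvec r Q v) (mvec r A v) = complex_of_real h" if v: "vnorm r v = 1" for v
  proof -
    define h where "h = cdot r (mvec r Q v) (mvec r A v)"
    \<comment> \<open>The phase of \<open>h\<close>, with default 1 at \<open>h = 0\<close>. The
      update then changes the objective by \<open>cmod h - Re h\<close>, which is positive unless
      \<open>h\<close> is already real and nonnegative.\<close>
    define \<zeta> where "\<zeta> = (if h = 0 then 1 else h / cmod h)"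
    have \<zeta>: "cmod \<zeta> = 1" by (simp add: \<zeta>_def norm_divide)
    have h\<zeta>: "cnj \<zeta> * h = cmod h"
      by (simp add: \<zeta>_def complex_norm_square[symmetric] field_simps power2_eq_square)
    define G where "G = (\<lambda>i b. Q i b + (\<zeta> - 1) * mvec r Q v i * cnj (v b))"
    \<comment> \<open>Entries outside the range are reset to zero so that the competitor lies in the
      compact set.\<close>
    define Q' where "Q' = (\<lambda>i j. if i < r \<and> j < r then G i j else 0)"
    have "unitary_mat r G"
      unfolding G_def by (rule unitary_rank_one_update[OF U v \<zeta>])
    then have U': "unitary_mat r Q'"
      unfolding unitary_mat_def by (rule orthonormal_cols_cong) (simp add: Q'_def)
    have "Q' \<in> K"
      using cmod_orthonormal_entry_le[of r r Q'] U' by (auto simp: K_def Q'_def unitary_mat_def)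
    have "(\<Sum>b<r. cdot r (col Q' b) (col A b))
        = (\<Sum>b<r. cdot r (col Q b) (col A b) + cnj (\<zeta> - 1) * (cdot r (mvec r Q v) (col A b) * v b))"
    proof (rule sum.cong)
      fix b assume "b \<in> {..<r}"
      then have "cdot r (col Q' b) (col A b) = (\<Sum>i<r. cnj (G i b) * A i b)"
        by (simp add: cdot_def col_def Q'_def)
      also have "\<dots> = cdot r (col Q b) (col A b) + cnj (\<zeta> - 1) * (cdot r (mvec r Q v) (col A b) * v b)"
        unfolding cdot_def sum_distrib_left sum_distrib_right sum.distrib[symmetric]
        by (rule sum.cong) (simp_all add: G_def col_def algebra_simps)
      finally show "cdot r (col Q' b) (col A b) = \<dots>" .
    qed simp
    also have "\<dots> = (\<Sum>b<r. cdot r (col Q b) (col A b)) + cnj (\<zeta> - 1) * h"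
      by (simp add: h_def cdot_mvec_right[of r "mvec r Q v"] sum.distrib sum_distrib_left)
    finally have "f Q' = f Q + Re (cnj (\<zeta> - 1) * h)"
      by (simp only: f_def plus_complex.sel)
    also have "cnj (\<zeta> - 1) * h = cnj \<zeta> * h - h"
      by (simp add: left_diff_distrib)
    finally have "f Q' = f Q + Re (cnj \<zeta> * h - h)" .
    with max[OF \<open>Q' \<in> K\<close>] have "cmod h \<le> Re h"
      unfolding h\<zeta> by simp
    then have "Re h = cmod h" using complex_Re_le_cmod[of h] by linarith
    moreover from this have "Im h = 0" using cmod_power2[of h] by simp
    ultimately have "h = of_real (cmod h)" by (simp add: complex_eq_iff)
    then show ?thesis unfolding h_def[symmetric] using norm_ge_zero by blast
  qed
  have "\<exists>h\<ge>0. cdot r (mvec r Q v) (mvec r A v) = complex_of_real h" for v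
  proof (cases "vnorm r v = 0")
    case True
    then have "cdot r (mvec r Q v) (mvec r A v) = 0"
      by (simp add: vnorm_eq_0_iff mvec_def cdot_def)
    then show ?thesis by (intro exI[of _ 0]) simp
  next
    case False
    define c where "c = vnorm r v"
    define w where "w = (\<lambda>i. of_real (1 / c) * v i)"
    have c: "c > 0" using False vnorm_nonneg[of r v] unfolding c_def by linarith
    have "vnorm r w = 1"
      unfolding w_def vnorm_scale norm_of_real using c by (simp add: c_def)
    from unit[OF this] obtain h where h: "h \<ge> 0" "cdot r (mvec r Q w) (mvec r A w) = of_real h" by blast
    have mv: "mvec r B v = (\<lambda>i. of_real c * mvec r B w i)" for B
      using c by (simp add: mvec_def w_def sum_distrib_left)
    have "cdot r (mvec r Q v) (mvec r A v) = of_real (c * c * h)"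
      unfolding mv cdot_scale_left cdot_scale_right h(2) by simp
    with h(1) show ?thesis by (intro exI[of _ "c * c * h"]) simp
  qed
  with U show ?thesis by blast
qed

section \<open>Gram matrix identities and the alignment inequality\<close>

lemma inner_complex_Re: "inner (x::complex) y = Re (cnj x * y)"
  by (simp add: inner_complex_def)

text \<open>The real trace pairing of a Gram matrix with \<open>S\<close> is a sum of quadratic
  forms of \<open>S\<close> over the conjugated rows of \<open>D\<close>. Lower bounds on quadratic
  forms thereby become lower bounds on trace pairings.\<close>

lemma sum_inner_gram:
  "(\<Sum>a<r. \<Sum>b<r. inner (cdot n (col D a) (col D b)) (S a b))
     = (\<Sum>i<n. Re (cdot r (\<lambda>a. cnj (D i a)) (mvec r S (\<lambda>a. cnj (D i a)))))"
proof -
  have "(\<Sum>a<r. \<Sum>b<r. cnj (cdot n (col D a) (col D b)) * S a b)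
      = (\<Sum>a<r. \<Sum>b<r. \<Sum>i<n. D i a * S a b * cnj (D i b))"
    by (simp add: cdot_def col_def sum_distrib_left sum_distrib_right mult_ac)
  also have "\<dots> = (\<Sum>i<n. \<Sum>a<r. \<Sum>b<r. D i a * S a b * cnj (D i b))"
    by (simp only: sum.swap[of _ "{..<n}"])
  also have "\<dots> = (\<Sum>i<n. cdot r (\<lambda>a. cnj (D i a)) (mvec r S (\<lambda>a. cnj (D i a))))"
    by (simp add: cdot_def mvec_def sum_distrib_left mult_ac)
  finally show ?thesis
    unfolding inner_complex_Re Re_sum[symmetric] by (rule arg_cong)
qed

text \<open>Cyclicity of the trace: the pairing of two products \<open>L R\<^sup>*\<close> depends
  only on the Gram blocks, so sums over n1 x n2 entries reduce to sums over r x r entries.\<close>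

lemma sum_inner_outer:
  "(\<Sum>i<n1. \<Sum>j<n2. inner (\<Sum>a<r. L i a * cnj (R j a)) (\<Sum>a<r. L' i a * cnj (R' j a)))
     = (\<Sum>a<r. \<Sum>b<r. inner (cdot n2 (col R a) (col R' b)) (cdot n1 (col L a) (col L' b)))"
proof -
  have "(\<Sum>i<n1. \<Sum>j<n2. cnj (\<Sum>a<r. L i a * cnj (R j a)) * (\<Sum>a<r. L' i a * cnj (R' j a)))
      = (\<Sum>i<n1. \<Sum>j<n2. \<Sum>a<r. \<Sum>b<r. cnj (L i a) * R j a * (L' i b * cnj (R' j b)))"
    by (simp add: sum_distrib_left sum_distrib_right)
       (intro sum.cong refl sum.swap)
  also have "\<dots> = (\<Sum>a<r. \<Sum>b<r. \<Sum>i<n1. \<Sum>j<n2. cnj (L i a) * R j a * (L' i b * cnj (R' j b)))"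
    by (simp only: sum.swap[of _ "{..<r}" "{..<n2}"] sum.swap[of _ "{..<r}" "{..<n1}"])
  also have "\<dots> = (\<Sum>a<r. \<Sum>b<r. (\<Sum>i<n1. cnj (L i a) * L' i b) * (\<Sum>j<n2. R j a * cnj (R' j b)))"
    by (simp add: sum_product mult_ac)
  also have "\<dots> = (\<Sum>a<r. \<Sum>b<r. cnj (cdot n2 (col R a) (col R' b)) * cdot n1 (col L a) (col L' b))"
    by (simp add: cdot_def col_def mult.commute)
  finally show ?thesis
    unfolding inner_complex_Re Re_sum[symmetric] by (rule arg_cong)
qed

text \<open>Substituting \<open>g = e / 2 - b + p\<close> makes the difference a quadratic form in e
  and p - 2 b. With weights c1 and c2 on the two inner products, nonnegativity on p = 2 b (exact
  recovery) forces c2 = 4 - 2 c1, and then (4 - c1)^2 \<le> 8 is required. The rational solution c1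
  = c2 = 4/3 is used.\<close>

lemma gram_entry_inequality:
  fixes g b p e :: complex
  assumes "e = 2 * g + 2 * b - 2 * p"
  shows "4 / 3 * inner e p + 4 / 3 * inner e b \<le> 4 * (cmod g)\<^sup>2 + 4 * (cmod b)\<^sup>2 - 2 * (cmod p)\<^sup>2"
proof -
  have real: "4 / 3 * (e * p) + 4 / 3 * (e * b) \<le> 4 * g\<^sup>2 + 4 * b\<^sup>2 - 2 * p\<^sup>2"
    if "e = 2 * g + 2 * b - 2 * p" for g b p e :: real
  proof -
    have "4 * g\<^sup>2 + 4 * b\<^sup>2 - 2 * p\<^sup>2 - (4 / 3 * (e * p) + 4 / 3 * (e * b))
        = (e + 4 / 3 * (p - 2 * b))\<^sup>2 + 2 / 9 * (p - 2 * b)\<^sup>2"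
      unfolding that by (simp add: power2_eq_square field_simps)
    moreover have "0 \<le> (e + 4 / 3 * (p - 2 * b))\<^sup>2 + 2 / 9 * (p - 2 * b)\<^sup>2"
      by simp
    ultimately show ?thesis by linarith
  qed
  have "Re e = 2 * Re g + 2 * Re b - 2 * Re p" "Im e = 2 * Im g + 2 * Im b - 2 * Im p"
    using assms by simp_all
  from real[OF this(1)] real[OF this(2)] show ?thesis
    by (simp add: inner_complex_def cmod_power2 algebra_simps)
qed

text \<open>Tu et al., Lemma 5.4, for two balanced factorisations that are already aligned. The argument needs
  no closeness of the factors.\<close>

lemma aligned_balanced_factors:
  assumes bal: "\<And>a b. a < r \<Longrightarrow> b < r \<Longrightarrow> cdot n1 (col L a) (col L b) = cdot n2 (col R a) (col R b)"
    and bal': "\<And>a b. a < r \<Longrightarrow> b < r \<Longrightarrow> cdot n1 (col L' a) (col L' b) = cdot n2 (col R' a) (col R' b)"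
    and P: "P = (\<lambda>a b. cdot n1 (col L' a) (col L b) + cdot n2 (col R' a) (col R b))"
    and herm: "\<And>a b. a < r \<Longrightarrow> b < r \<Longrightarrow> P b a = cnj (P a b)"
    and psd: "\<And>v. 0 \<le> Re (cdot r v (mvec r P v))"
    and coer: "\<And>v. m * (vnorm r v)\<^sup>2 \<le> Re (cdot r v (mvec r (\<lambda>a b. cdot n1 (col L' a) (col L' b)) v))"
  shows "m * ((\<Sum>i<n1. \<Sum>a<r. (cmod (L i a - L' i a))\<^sup>2) + (\<Sum>j<n2. \<Sum>a<r. (cmod (R j a - R' j a))\<^sup>2))
    \<le> 3 * (\<Sum>i<n1. \<Sum>j<n2. (cmod ((\<Sum>a<r. L i a * cnj (R j a)) - (\<Sum>a<r. L' i a * cnj (R' j a))))\<^sup>2)"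
proof -
  define G where "G = (\<lambda>a b. cdot n1 (col L a) (col L b))"
  define B where "B = (\<lambda>a b. cdot n1 (col L' a) (col L' b))"
  define D where "D = (\<lambda>i a. L i a - L' i a)"
  define F where "F = (\<lambda>i a. R i a - R' i a)"
  define E where "E = (\<lambda>a b. cdot n1 (col D a) (col D b) + cdot n2 (col F a) (col F b))"
  \<comment> \<open>Balancedness identifies the two Gram matrices of each pair, and the Hermitian
    symmetry of \<open>P\<close> identifies the two cross terms; hence the three factors 2.\<close>
  have E: "E a b = 2 * G a b + 2 * B a b - 2 * P a b" if "a < r" "b < r" for a b
  proof -
    have colD: "col D a = (\<lambda>i. col L a i - col L' a i)" and colF: "col F a = (\<lambda>i. col R a i - col R' a i)" for a
      by (simp_all add: D_def F_def col_def)
    have "E a b = 2 * G a b + 2 * B a b - P a b - cnj (P b a)"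
      unfolding E_def colD colF cdot_diff_left cdot_diff_right
      using bal[OF that] bal'[OF that]
      by (simp add: P G_def B_def cnj_cdot algebra_simps)
    with herm[OF that] show ?thesis by simp
  qed
  define \<Delta> where "\<Delta> = (\<Sum>i<n1. \<Sum>a<r. (cmod (D i a))\<^sup>2) + (\<Sum>j<n2. \<Sum>a<r. (cmod (F j a))\<^sup>2)"
  \<comment> \<open>\<open>E\<close> is a sum of two Gram matrices and \<open>P\<close> is positive
    semidefinite, so their pairing is nonnegative.\<close>
  have EP: "0 \<le> (\<Sum>a<r. \<Sum>b<r. inner (E a b) (P a b))"
    unfolding E_def inner_add_left sum.distrib sum_inner_gram
    by (intro add_nonneg_nonneg sum_nonneg psd)
  have "m * \<Delta> = (\<Sum>i<n1. m * (vnorm r (\<lambda>a. cnj (D i a)))\<^sup>2) + (\<Sum>i<n2. m * (vnorm r (\<lambda>a. cnj (F i a)))\<^sup>2)"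
    by (simp add: \<Delta>_def distrib_left sum_distrib_left vnorm_sq)
  also have "\<dots> \<le> (\<Sum>a<r. \<Sum>b<r. inner (E a b) (B a b))"
    unfolding E_def inner_add_left sum.distrib sum_inner_gram B_def
    by (intro add_mono sum_mono coer)
  finally have EB: "m * \<Delta> \<le> (\<Sum>a<r. \<Sum>b<r. inner (E a b) (B a b))" .
  define g where "g = (\<Sum>a<r. \<Sum>b<r. (cmod (G a b))\<^sup>2)"
  define \<beta> where "\<beta> = (\<Sum>a<r. \<Sum>b<r. (cmod (B a b))\<^sup>2)"
  define \<pi> where "\<pi> = (\<Sum>a<r. \<Sum>b<r. (cmod (P a b))\<^sup>2)"
  define x where "x = (\<Sum>a<r. \<Sum>b<r. inner (cdot n2 (col R a) (col R' b)) (cdot n1 (col L a) (col L' b)))"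
  have "(\<Sum>a<r. \<Sum>b<r. 4 / 3 * inner (E a b) (P a b) + 4 / 3 * inner (E a b) (B a b))
      \<le> (\<Sum>a<r. \<Sum>b<r. 4 * (cmod (G a b))\<^sup>2 + 4 * (cmod (B a b))\<^sup>2 - 2 * (cmod (P a b))\<^sup>2)"
    by (intro sum_mono gram_entry_inequality E) auto
  then have main: "4 / 3 * (\<Sum>a<r. \<Sum>b<r. inner (E a b) (P a b)) + 4 / 3 * (\<Sum>a<r. \<Sum>b<r. inner (E a b) (B a b))
      \<le> 4 * g + 4 * \<beta> - 2 * \<pi>"
    by (simp add: g_def \<beta>_def \<pi>_def sum.distrib sum_subtractf sum_distrib_left)
  \<comment> \<open>Entrywise polarization, |u + v|^2 = |u - v|^2 + 4 <u, v>, applied to the two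
    summands whose conjugated sum is \<open>P b a\<close>.\<close>
  have "4 * x = (\<Sum>a<r. \<Sum>b<r. 4 * inner (cdot n2 (col R a) (col R' b)) (cdot n1 (col L a) (col L' b)))"
    by (simp add: x_def sum_distrib_left)
  also have "\<dots> \<le> (\<Sum>a<r. \<Sum>b<r. (cmod (P b a))\<^sup>2)"
  proof (intro sum_mono)
    fix a b
    have "P b a = cnj (cdot n1 (col L a) (col L' b) + cdot n2 (col R a) (col R' b))"
      by (simp add: P cnj_cdot)
    then have "(cmod (P b a))\<^sup>2 = (cmod (cdot n2 (col R a) (col R' b) + cdot n1 (col L a) (col L' b)))\<^sup>2"
      by (simp only: complex_mod_cnj add.commute)
    also have "\<dots> = (cmod (cdot n2 (col R a) (col R' b) - cdot n1 (col L a) (col L' b)))\<^sup>2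
        + 4 * inner (cdot n2 (col R a) (col R' b)) (cdot n1 (col L a) (col L' b))"
      by (simp add: power2_norm_eq_inner inner_add_left inner_add_right inner_diff_left inner_diff_right inner_commute)
    finally show "4 * inner (cdot n2 (col R a) (col R' b)) (cdot n1 (col L a) (col L' b)) \<le> (cmod (P b a))\<^sup>2"
      by simp
  qed
  also have "\<dots> = \<pi>" unfolding \<pi>_def by (rule sum.swap)
  finally have x: "4 * x \<le> \<pi>" .
  define X where "X = (\<Sum>i<n1. \<Sum>j<n2. (cmod ((\<Sum>a<r. L i a * cnj (R j a)) - (\<Sum>a<r. L' i a * cnj (R' j a))))\<^sup>2)"
  have "X = (\<Sum>i<n1. \<Sum>j<n2. inner (\<Sum>a<r. L i a * cnj (R j a)) (\<Sum>a<r. L i a * cnj (R j a))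
      + inner (\<Sum>a<r. L' i a * cnj (R' j a)) (\<Sum>a<r. L' i a * cnj (R' j a))
      - 2 * inner (\<Sum>a<r. L i a * cnj (R j a)) (\<Sum>a<r. L' i a * cnj (R' j a)))"
    unfolding X_def
    by (intro sum.cong refl)
       (simp add: power2_norm_eq_inner inner_diff_left inner_diff_right inner_commute)
  also have "\<dots> = g + \<beta> - 2 * x"
  proof -
    have "g = (\<Sum>i<n1. \<Sum>j<n2. inner (\<Sum>a<r. L i a * cnj (R j a)) (\<Sum>a<r. L i a * cnj (R j a)))"
      unfolding sum_inner_outer g_def G_def by (simp add: bal dot_square_norm)
    moreover have "\<beta> = (\<Sum>i<n1. \<Sum>j<n2. inner (\<Sum>a<r. L' i a * cnj (R' j a)) (\<Sum>a<r. L' i a * cnj (R' j a)))"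
      unfolding sum_inner_outer \<beta>_def B_def by (simp add: bal' dot_square_norm)
    ultimately show ?thesis
      unfolding x_def sum_inner_outer[symmetric] by (simp add: sum.distrib sum_subtractf sum_distrib_left)
  qed
  finally have "X = g + \<beta> - 2 * x" .
  \<comment> \<open>4/3 m \<Delta> \<le> 4 g + 4 \<beta> - 2 \<pi> \<le> 4 (g + \<beta> - 2 x) = 4
    X, which produces the factor 3.\<close>
  with main EP EB x have "m * \<Delta> \<le> 3 * X" by simp
  then show ?thesis by (simp add: \<Delta>_def X_def D_def F_def)
qed

text \<open>By counting: the squared moduli of all entries sum to r, and Bessel's inequality allows
  each of the r rows at most 1, so every row has exactly 1. Then each standard basis vector has zero
  residual and equals its expansion in the columns, which is row orthonormality.\<close>

lemma unitary_mat_transpose: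
  assumes "unitary_mat r Q"
  shows "unitary_mat r (\<lambda>i j. Q j i)"
proof -
  have Q: "orthonormal_cols r r Q" using assms by (simp add: unitary_mat_def)
  define e where "e = (\<lambda>(i::nat) j. if j = i then 1 else (0::complex))"
  have ce: "cdot r (col Q l) (e i) = cnj (Q i l)" if "i < r" for i l
  proof -
    have "cdot r (col Q l) (e i) = (\<Sum>j<r. if j = i then cnj (Q j l) else 0)"
      unfolding cdot_def by (rule sum.cong) (auto simp: e_def col_def)
    with that show ?thesis by simp
  qed
  have e1: "(vnorm r (e i))\<^sup>2 = 1" if "i < r" for i
  proof -
    have "(vnorm r (e i))\<^sup>2 = (\<Sum>j<r. if j = i then 1 else 0)"
      unfolding vnorm_sq by (rule sum.cong) (auto simp: e_def)
    with that show ?thesis by simp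
  qed
  let ?row = "\<lambda>i. (vnorm r (\<lambda>l. cdot r (col Q l) (e i)))\<^sup>2"
  have le: "?row i \<le> 1" if "i < r" for i
    using power_mono[OF bessel[OF Q, of "e i"], of 2] e1[OF that] by simp
  have "(\<Sum>i<r. ?row i) = (\<Sum>i<r. \<Sum>l<r. (cmod (Q i l))\<^sup>2)"
    unfolding vnorm_sq by (simp add: ce)
  also have "\<dots> = (\<Sum>l<r. (vnorm r (col Q l))\<^sup>2)"
    unfolding vnorm_sq col_def by (rule sum.swap)
  also have "\<dots> = real r" by (simp add: vnorm_col[OF Q])
  finally have "(\<Sum>i<r. 1 - ?row i) = 0" by (simp add: sum_subtractf)
  then have eq: "1 - ?row i = 0" if "i < r" for i
    using that le by (subst (asm) sum_nonneg_eq_0_iff) auto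
  have "(\<Sum>l<r. cnj (Q i l) * Q j l) = (if i = j then 1 else 0)" if "i < r" "j < r" for i j
  proof -
    have "(vnorm r (\<lambda>j. e i j - mvec r Q (\<lambda>l. cdot r (col Q l) (e i)) j))\<^sup>2 = 0"
      using vnorm_residual[OF Q, of "e i"] eq[OF that(1)] e1[OF that(1)] by simp
    then have "e i j = mvec r Q (\<lambda>l. cdot r (col Q l) (e i)) j"
      using that(2) by (simp add: vnorm_eq_0_iff)
    also have "\<dots> = (\<Sum>l<r. cnj (Q i l) * Q j l)"
      by (simp add: mvec_def ce[OF that(1)] mult.commute)
    finally show ?thesis by (auto simp: e_def)
  qed
  then show ?thesis by (simp add: unitary_mat_def orthonormal_cols_def)
qed

text \<open>Polarization: the vectors e_a, e_b, e_a + e_b and e_a + i e_b determine the real and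
  imaginary parts of the entries involved.\<close>

lemma hermitian_if_real_quadratic_form:
  assumes real: "\<And>v. Im (cdot r v (mvec r P v)) = 0" and ab: "a < r" "b < r"
  shows "P b a = cnj (P a b)"
proof -
  have form: "cdot r (\<lambda>i. (if i = a then x else 0) + (if i = b then y else 0))
      (mvec r P (\<lambda>i. (if i = a then x else 0) + (if i = b then y else 0)))
    = cnj x * P a a * x + cnj x * P a b * y + cnj y * P b a * x + cnj y * P b b * y" for x y
  proof -
    have mv: "mvec r P (\<lambda>i. (if i = a then x else 0) + (if i = b then y else 0)) i = P i a * x + P i b * y" for i
    proof -
      have "mvec r P (\<lambda>i. (if i = a then x else 0) + (if i = b then y else 0)) i
        = (\<Sum>j<r. if j = a then P i j * x else 0) + (\<Sum>j<r. if j = b then P i j * y else 0)"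
        unfolding mvec_def sum.distrib[symmetric] by (rule sum.cong) (auto simp: algebra_simps)
      with ab show ?thesis by simp
    qed
    have "cdot r (\<lambda>i. (if i = a then x else 0) + (if i = b then y else 0)) w = cnj x * w a + cnj y * w b" for w
    proof -
      have "cdot r (\<lambda>i. (if i = a then x else 0) + (if i = b then y else 0)) w
        = (\<Sum>j<r. if j = a then cnj x * w j else 0) + (\<Sum>j<r. if j = b then cnj y * w j else 0)"
        unfolding cdot_def sum.distrib[symmetric] by (rule sum.cong) (auto simp: algebra_simps)
      with ab show ?thesis by simp
    qed
    then show ?thesis by (simp add: mv algebra_simps)
  qed
  have im: "Im (cnj x * P a a * x + cnj x * P a b * y + cnj y * P b a * x + cnj y * P b b * y) = 0" for x y
    unfolding form[symmetric] by (rule real)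
  have "Im (P a a) = 0" "Im (P b b) = 0" using im[of 1 0] im[of 0 1] by simp_all
  with im[of 1 1] im[of 1 \<i>] show ?thesis by (simp add: complex_eq_iff)
qed

section \<open>Row norms and the projection onto row-norm balls\<close>

lemma fro_sq: "(fro a b A)\<^sup>2 = (\<Sum>i<a. \<Sum>j<b. (cmod (A i j))\<^sup>2)"
  by (simp add: fro_def sum_nonneg)

lemma norm2inf_sq_le_iff:
  "(norm2inf a b L)\<^sup>2 \<le> B \<longleftrightarrow> 0 \<le> B \<and> (\<forall>i<a. (vnorm b (L i))\<^sup>2 \<le> B)"
proof -
  have nn: "0 \<le> norm2inf a b L" unfolding norm2inf_def by (rule Max_ge) auto
  have sq: "x\<^sup>2 \<le> B \<longleftrightarrow> 0 \<le> B \<and> x \<le> sqrt B" if "0 \<le> x" for x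
  proof (cases "0 \<le> B")
    case True
    then show ?thesis using that real_sqrt_le_iff[of "x\<^sup>2" B] by simp
  next
    case False
    then show ?thesis using zero_le_power2[of x] by linarith
  qed
  have "norm2inf a b L \<le> sqrt B \<longleftrightarrow> 0 \<le> sqrt B \<and> (\<forall>i<a. vnorm b (L i) \<le> sqrt B)"
  proof -
    have "norm2inf a b L = Max (insert 0 ((\<lambda>i. vnorm b (L i)) ` {..<a}))"
      by (simp add: norm2inf_def vnorm_def)
    also have "\<dots> \<le> sqrt B \<longleftrightarrow> (\<forall>x\<in>insert 0 ((\<lambda>i. vnorm b (L i)) ` {..<a}). x \<le> sqrt B)"
      by (rule Max_le_iff) auto
    finally show ?thesis by auto
  qed
  then show ?thesis
    unfolding sq[OF nn] sq[OF vnorm_nonneg] by auto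
qed

text \<open>\<open>L\<close> is known only as a minimiser. Comparing it with points of the segment
  towards \<open>Y\<close>, which stays in the convex ball, gives the variational inequality
  \<open>0 \<le> ip\<close> (an obtuse angle at \<open>L\<close>); expanding the square around
  \<open>L\<close> then gives the claim.\<close>

lemma proj_rowball_nonexpansive:
  assumes proj: "is_proj_rowball a b B Lt L" and Y: "(norm2inf a b Y)\<^sup>2 \<le> B"
  shows "(fro a b (\<lambda>i j. L i j - Y i j))\<^sup>2 \<le> (fro a b (\<lambda>i j. Lt i j - Y i j))\<^sup>2"
proof -
  define ip where "ip = (\<Sum>i<a. \<Sum>j<b. inner (L i j - Lt i j) (Y i j - L i j))"
  define q where "q = (fro a b (\<lambda>i j. Y i j - L i j))\<^sup>2"
  have L: "0 \<le> B" "\<And>i. i < a \<Longrightarrow> (vnorm b (L i))\<^sup>2 \<le> B" "\<And>i. i < a \<Longrightarrow> (vnorm b (Y i))\<^sup>2 \<le> B"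
    using proj Y unfolding is_proj_rowball_def norm2inf_sq_le_iff by auto
  have var: "0 \<le> 2 * t * ip + t\<^sup>2 * q" if t: "0 \<le> t" "t \<le> 1" for t
  proof -
    define Z where "Z = (\<lambda>i j. of_real (1 - t) * L i j + of_real t * Y i j)"
    have "(vnorm b (Z i))\<^sup>2 \<le> B" if i: "i < a" for i
    proof -
      have "vnorm b (Z i) \<le> vnorm b (\<lambda>j. of_real (1 - t) * L i j) + vnorm b (\<lambda>j. of_real t * Y i j)"
        unfolding Z_def by (rule vnorm_triangle)
      also have "\<dots> = (1 - t) * vnorm b (L i) + t * vnorm b (Y i)"
        using t unfolding vnorm_scale norm_of_real by simp
      also have "\<dots> \<le> (1 - t) * sqrt B + t * sqrt B"
        using t L(2,3)[OF i] by (intro add_mono mult_left_mono real_le_rsqrt) auto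
      also have "\<dots> = sqrt B" by (simp add: algebra_simps)
      finally have "(vnorm b (Z i))\<^sup>2 \<le> (sqrt B)\<^sup>2" by (intro power_mono) auto
      with L(1) show ?thesis by simp
    qed
    then have "(norm2inf a b Z)\<^sup>2 \<le> B" unfolding norm2inf_sq_le_iff using L(1) by blast
    then have "fro a b (\<lambda>i j. L i j - Lt i j) \<le> fro a b (\<lambda>i j. Z i j - Lt i j)"
      using proj unfolding is_proj_rowball_def by blast
    then have "(fro a b (\<lambda>i j. L i j - Lt i j))\<^sup>2 \<le> (fro a b (\<lambda>i j. Z i j - Lt i j))\<^sup>2"
      by (intro power_mono) (auto simp: fro_def sum_nonneg)
    also have "\<dots> = (\<Sum>i<a. \<Sum>j<b. (cmod (L i j - Lt i j))\<^sup>2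
        + 2 * t * inner (L i j - Lt i j) (Y i j - L i j) + t\<^sup>2 * (cmod (Y i j - L i j))\<^sup>2)"
      unfolding fro_sq
    proof (intro sum.cong refl)
      fix i j
      have "Z i j - Lt i j = (L i j - Lt i j) + t *\<^sub>R (Y i j - L i j)"
        by (simp add: Z_def scaleR_conv_of_real algebra_simps)
      then show "(cmod (Z i j - Lt i j))\<^sup>2 = (cmod (L i j - Lt i j))\<^sup>2
        + 2 * t * inner (L i j - Lt i j) (Y i j - L i j) + t\<^sup>2 * (cmod (Y i j - L i j))\<^sup>2"
        by (simp only: power2_norm_eq_inner inner_add_left inner_add_right inner_scaleR_left
              inner_scaleR_right inner_commute[of "Y i j - L i j" "L i j - Lt i j"])
           (simp add: power2_eq_square algebra_simps)
    qed
    also have "\<dots> = (fro a b (\<lambda>i j. L i j - Lt i j))\<^sup>2 + 2 * t * ip + t\<^sup>2 * q"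
      by (simp add: fro_sq ip_def q_def sum.distrib sum_distrib_left)
    finally show ?thesis by simp
  qed
  have "0 \<le> ip"
  proof (rule ccontr)
    assume neg: "\<not> 0 \<le> ip"
    have "0 \<le> q" by (simp add: q_def)
    \<comment> \<open>This t lies in (0, 1] when \<open>ip < 0\<close>, and it turns
      \<open>2 * ip + t * q\<close> into (1 + t) ip, which is negative.\<close>
    define t where "t = - ip / (q - ip)"
    have t: "0 < t" "t \<le> 1" "t * (q - ip) = - ip"
      using neg \<open>0 \<le> q\<close> by (auto simp: t_def field_simps)
    from var[of t] t(1,2) have "0 \<le> t * (2 * ip + t * q)"
      by (simp add: power2_eq_square algebra_simps)
    with t(1) have "0 \<le> 2 * ip + t * q" by (simp add: zero_le_mult_iff)
    also have "\<dots> = ip + t * ip" using t(3) by (simp add: algebra_simps)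
    also have "\<dots> < 0" using neg t(1) by (intro add_neg_neg mult_pos_neg) auto
    finally show False by simp
  qed
  have "(fro a b (\<lambda>i j. Lt i j - Y i j))\<^sup>2 = (\<Sum>i<a. \<Sum>j<b. (cmod (L i j - Y i j))\<^sup>2
        + 2 * inner (L i j - Lt i j) (Y i j - L i j) + (cmod (L i j - Lt i j))\<^sup>2)"
    unfolding fro_sq
    by (intro sum.cong refl)
       (simp add: power2_norm_eq_inner inner_diff_left inner_diff_right inner_commute)
  also have "\<dots> = (fro a b (\<lambda>i j. L i j - Y i j))\<^sup>2 + 2 * ip + (fro a b (\<lambda>i j. L i j - Lt i j))\<^sup>2"
    by (simp add: fro_sq ip_def sum.distrib sum_distrib_left)
  finally show ?thesis using \<open>0 \<le> ip\<close> by simp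
qed

section \<open>Factors of singular value decompositions under unitary alignment\<close>

lemma mvec_matmul: "mvec r (matmul k A Q) v = mvec k A (mvec r Q v)"
  unfolding mvec_def matmul_def sum_distrib_left sum_distrib_right
  by (rule ext, subst sum.swap) (simp add: mult_ac)

lemma col_matmul: "col (matmul k A Q) b = mvec k A (col Q b)"
  by (simp add: col_def matmul_def mvec_def)

lemma gram_quadratic_form:
  "cdot r v (mvec r (\<lambda>a b. cdot n (col L a) (col R b)) v) = cdot n (mvec r L v) (mvec r R v)"
proof -
  have "cdot n (mvec r L v) (mvec r R v) = (\<Sum>a<r. cnj (v a) * (\<Sum>b<r. cdot n (col L a) (col R b) * v b))"
    unfolding cdot_mvec_left[of n r L v] unfolding cdot_mvec_right ..
  then show ?thesis by (simp add: cdot_def[of r] mvec_def[of r "\<lambda>a b. cdot n (col L a) (col R b)"])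
qed

lemma mvec_half_factor: "mvec r (half_factor U s) v = mvec r U (\<lambda>l. of_real (sqrt (s l)) * v l)"
  by (simp add: half_factor_def mvec_def mult_ac)

lemma cdot_half_factor:
  assumes "orthonormal_cols n r U" "a < r" "b < r" "0 \<le> s a"
  shows "cdot n (col (half_factor U s) a) (col (half_factor U s) b) = (if a = b then of_real (s a) else 0)"
proof -
  have "col (half_factor U s) l = (\<lambda>i. of_real (sqrt (s l)) * col U l i)" for l
    by (simp add: half_factor_def col_def mult.commute)
  then have "cdot n (col (half_factor U s) a) (col (half_factor U s) b)
      = of_real (sqrt (s a) * sqrt (s b)) * cdot n (col U a) (col U b)"
    by (simp add: cdot_scale_left cdot_scale_right)
  with assms show ?thesis by (auto simp: orthonormal_cols_cdot simp del: of_real_mult)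
qed

lemma vnorm_row_matmul_unitary:
  assumes "unitary_mat r Q"
  shows "vnorm r (matmul r A Q i) = vnorm r (A i)"
proof -
  have "matmul r A Q i = mvec r (\<lambda>a k. Q k a) (A i)"
    by (simp add: matmul_def mvec_def mult.commute)
  with unitary_mat_transpose[OF assms] show ?thesis
    by (simp add: vnorm_mvec_orthonormal unitary_mat_def)
qed

lemma matmul_unitary_outer:
  assumes "unitary_mat r Q"
  shows "(\<Sum>a<r. matmul r L Q i a * cnj (matmul r R Q j a)) = (\<Sum>k<r. L i k * cnj (R j k))"
proof -
  have T: "orthonormal_cols r r (\<lambda>i j. Q j i)"
    using unitary_mat_transpose[OF assms] by (simp add: unitary_mat_def)
  have row: "matmul r A Q i = mvec r (\<lambda>a k. Q k a) (A i)" for A i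
    by (simp add: matmul_def mvec_def mult.commute)
  have "(\<Sum>a<r. matmul r L Q i a * cnj (matmul r R Q j a))
      = cdot r (mvec r (\<lambda>a k. Q k a) (R j)) (mvec r (\<lambda>a k. Q k a) (L i))"
    unfolding row by (simp add: cdot_def mult.commute)
  also have "\<dots> = (\<Sum>k<r. cnj (R j k) * L i k)"
    unfolding cdot_mvec_left by (rule sum.cong) (simp_all add: cdot_col_mvec[OF T])
  finally show ?thesis by (simp add: mult.commute)
qed

lemma half_factor_outer:
  assumes "\<And>l. l < r \<Longrightarrow> 0 \<le> s l"
  shows "(\<Sum>l<r. half_factor U s i l * cnj (half_factor V s j l)) = (\<Sum>l<r. U i l * of_real (s l) * cnj (V j l))"
proof (rule sum.cong)
  fix l assume "l \<in> {..<r}"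
  then have "complex_of_real (sqrt (s l)) * of_real (sqrt (s l)) = of_real (s l)"
    using assms by (simp flip: of_real_mult)
  then have "U i l * cnj (V j l) * (complex_of_real (sqrt (s l)) * of_real (sqrt (s l))) = U i l * cnj (V j l) * of_real (s l)"
    by simp
  then show "half_factor U s i l * cnj (half_factor V s j l) = U i l * of_real (s l) * cnj (V j l)"
    by (simp add: half_factor_def mult_ac)
qed simp

text \<open>\<open>A\<close> is the cross-Gram matrix of the true factors against the estimated
  ones, and its polar factor \<open>Q\<close> makes \<open>Q\<^sup>* A\<close> positive
  semidefinite. Rotation by \<open>Q\<close> keeps the true pair balanced: both Gram matrices become
  \<open>Q\<^sup>* \<Sigma> Q\<close>, and m bounds their quadratic forms from below.\<close>

lemma svd_factors_procrustes:
  assumes U: "orthonormal_cols n1 r U" and V: "orthonormal_cols n2 r V"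
    and U0: "orthonormal_cols n1 r U0" and V0: "orthonormal_cols n2 r V0"
    and pos: "\<And>l. l < r \<Longrightarrow> 0 \<le> \<sigma> l" and pos0: "\<And>l. l < r \<Longrightarrow> 0 \<le> \<sigma>0 l"
    and m: "0 \<le> m" "\<And>l. l < r \<Longrightarrow> m \<le> \<sigma> l"
  shows "\<exists>Q. unitary_mat r Q \<and>
    m * ((fro n1 r (\<lambda>i a. half_factor U0 \<sigma>0 i a - matmul r (half_factor U \<sigma>) Q i a))\<^sup>2
       + (fro n2 r (\<lambda>j a. half_factor V0 \<sigma>0 j a - matmul r (half_factor V \<sigma>) Q j a))\<^sup>2)
    \<le> 3 * (\<Sum>i<n1. \<Sum>j<n2. (cmod ((\<Sum>l<r. U0 i l * of_real (\<sigma>0 l) * cnj (V0 j l))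
              - (\<Sum>l<r. U i l * of_real (\<sigma> l) * cnj (V j l))))\<^sup>2)"
proof -
  let ?L = "half_factor U0 \<sigma>0" and ?R = "half_factor V0 \<sigma>0"
  let ?L1 = "half_factor U \<sigma>" and ?R1 = "half_factor V \<sigma>"
  define A where "A = (\<lambda>k b. cdot n1 (col ?L1 k) (col ?L b) + cdot n2 (col ?R1 k) (col ?R b))"
  obtain Q where Q: "unitary_mat r Q"
    and psd: "\<And>v. \<exists>h\<ge>0. cdot r (mvec r Q v) (mvec r A v) = complex_of_real h"
    using polar_unitary[of r A] by blast
  have Q': "orthonormal_cols r r Q" using Q by (simp add: unitary_mat_def)
  define L' where "L' = matmul r ?L1 Q"
  define R' where "R' = matmul r ?R1 Q"
  define P where "P = (\<lambda>a b. cdot n1 (col L' a) (col ?L b) + cdot n2 (col R' a) (col ?R b))"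
  have P: "P a b = cdot r (col Q a) (col A b)" for a b
    unfolding P_def L'_def R'_def col_matmul cdot_mvec_left
    by (simp add: cdot_def[of r] A_def col_def[of Q] col_def[of "\<lambda>k b. _ k b + _ k b"] distrib_left sum.distrib)
  have form: "cdot r v (mvec r P v) = cdot r (mvec r Q v) (mvec r A v)" for v
    unfolding P by (rule gram_quadratic_form)
  have gram: "cdot n (col (matmul r (half_factor W \<sigma>) Q) a) (col (matmul r (half_factor W \<sigma>) Q) b)
      = (\<Sum>k<r. cnj (Q k a) * of_real (\<sigma> k) * Q k b)" if W: "orthonormal_cols n r W" for n W a b
  proof -
    have "cdot n (col (half_factor W \<sigma>) k) (mvec r (half_factor W \<sigma>) (col Q b)) = of_real (\<sigma> k) * Q k b"
      if "k < r" for k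
    proof -
      have "cdot n (col (half_factor W \<sigma>) k) (mvec r (half_factor W \<sigma>) (col Q b))
        = (\<Sum>l<r. if l = k then of_real (\<sigma> l) * Q l b else 0)"
        unfolding cdot_mvec_right
        by (rule sum.cong) (use that in \<open>auto simp: cdot_half_factor[OF W] pos col_def[of Q]\<close>)
      with that show ?thesis by simp
    qed
    then show ?thesis
      unfolding col_matmul cdot_mvec_left[of n r "half_factor W \<sigma>"]
      by (simp add: col_def[of Q] mult.assoc)
  qed
  have "m * ((\<Sum>i<n1. \<Sum>a<r. (cmod (?L i a - L' i a))\<^sup>2) + (\<Sum>j<n2. \<Sum>a<r. (cmod (?R j a - R' j a))\<^sup>2))
    \<le> 3 * (\<Sum>i<n1. \<Sum>j<n2. (cmod ((\<Sum>a<r. ?L i a * cnj (?R j a)) - (\<Sum>a<r. L' i a * cnj (R' j a))))\<^sup>2)"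
  proof (rule aligned_balanced_factors[OF _ _ P_def])
    show "cdot n1 (col ?L a) (col ?L b) = cdot n2 (col ?R a) (col ?R b)" if "a < r" "b < r" for a b
      using cdot_half_factor[of n1 r U0 a b \<sigma>0] cdot_half_factor[of n2 r V0 a b \<sigma>0] U0 V0 that pos0[OF that(1)]
      by simp
    show "cdot n1 (col L' a) (col L' b) = cdot n2 (col R' a) (col R' b)" for a b
      unfolding L'_def R'_def gram[OF U] gram[OF V] ..
    show "P b a = cnj (P a b)" if "a < r" "b < r" for a b
    proof (rule hermitian_if_real_quadratic_form[OF _ that])
      show "Im (cdot r v (mvec r P v)) = 0" for v
        unfolding form using psd[of v] by auto
    qed
    show "0 \<le> Re (cdot r v (mvec r P v))" for v
      unfolding form using psd[of v] by auto
    show "m * (vnorm r v)\<^sup>2 \<le> Re (cdot r v (mvec r (\<lambda>a b. cdot n1 (col L' a) (col L' b)) v))" for v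
    proof -
      have "m * (vnorm r v)\<^sup>2 = (vnorm r (\<lambda>l. of_real (sqrt m) * mvec r Q v l))\<^sup>2"
        using m by (simp add: vnorm_scale vnorm_mvec_orthonormal[OF Q'] power_mult_distrib)
      also have "\<dots> \<le> (vnorm r (\<lambda>l. of_real (sqrt (\<sigma> l)) * mvec r Q v l))\<^sup>2"
        using m pos by (intro power_mono vnorm_mono) (auto simp: norm_mult intro!: mult_right_mono)
      also have "\<dots> = (vnorm n1 (mvec r L' v))\<^sup>2"
        unfolding L'_def mvec_matmul mvec_half_factor vnorm_mvec_orthonormal[OF U] ..
      also have "\<dots> = Re (cdot r v (mvec r (\<lambda>a b. cdot n1 (col L' a) (col L' b)) v))"
        unfolding gram_quadratic_form cdot_self by simp
      finally show ?thesis .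
    qed
  qed
  moreover have "(\<Sum>a<r. L' i a * cnj (R' j a)) = (\<Sum>l<r. U i l * of_real (\<sigma> l) * cnj (V j l))" for i j
    unfolding L'_def R'_def matmul_unitary_outer[OF Q] using half_factor_outer[of r \<sigma>] pos by simp
  moreover have "(\<Sum>a<r. ?L i a * cnj (?R j a)) = (\<Sum>l<r. U0 i l * of_real (\<sigma>0 l) * cnj (V0 j l))" for i j
    using half_factor_outer[of r \<sigma>0] pos0 by simp
  ultimately show ?thesis
    using Q unfolding fro_sq L'_def R'_def by auto
qed

text \<open>The first standard basis vector attains \<open>sqrt (s 0)\<close>; Cauchy-Schwarz on the
  rows bounds the set above, so its supremum dominates this value. The inequality makes the row-norm
  balls large enough.\<close>

lemma spec_norm_half_factor_ge:
  assumes U: "orthonormal_cols n r U" and "0 < r" and "0 \<le> s 0"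
  shows "s 0 \<le> (spec_norm n r (half_factor U s))\<^sup>2"
proof -
  let ?A = "half_factor U s"
  let ?S = "{sqrt (\<Sum>i<n. (cmod (\<Sum>j<r. ?A i j * v j))\<^sup>2) | v. (\<Sum>j<r. (cmod (v j))\<^sup>2) \<le> 1}"
  have bound: "x \<le> L2_set (\<lambda>i. vnorm r (?A i)) {..<n}" if "x \<in> ?S" for x
  proof -
    from that obtain v where x: "x = sqrt (\<Sum>i<n. (cmod (\<Sum>j<r. ?A i j * v j))\<^sup>2)"
      and v: "(\<Sum>j<r. (cmod (v j))\<^sup>2) \<le> 1" by blast
    have "vnorm r v \<le> 1" using v by (simp add: vnorm_def)
    have "x = L2_set (\<lambda>i. cmod (\<Sum>j<r. ?A i j * v j)) {..<n}"
      by (simp add: x L2_set_def)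
    also have "\<dots> \<le> L2_set (\<lambda>i. vnorm r (?A i)) {..<n}"
    proof (rule L2_set_mono)
      fix i
      have "cmod (\<Sum>j<r. ?A i j * v j) \<le> vnorm r (?A i) * vnorm r v"
        by (rule cmod_sum_mult_le)
      also have "\<dots> \<le> vnorm r (?A i)" using \<open>vnorm r v \<le> 1\<close> by (simp add: mult_left_le)
      finally show "cmod (\<Sum>j<r. ?A i j * v j) \<le> vnorm r (?A i)" .
    qed simp
    finally show ?thesis .
  qed
  define e where "e = (\<lambda>j::nat. if j = 0 then 1 else (0::complex))"
  have "(\<Sum>j<r. ?A i j * e j) = ?A i 0" for i
  proof -
    have "(\<Sum>j<r. ?A i j * e j) = (\<Sum>j<r. if j = 0 then ?A i j else 0)"
      by (rule sum.cong) (auto simp: e_def)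
    with \<open>0 < r\<close> show ?thesis by simp
  qed
  then have "(\<Sum>i<n. (cmod (\<Sum>j<r. ?A i j * e j))\<^sup>2) = (vnorm n (\<lambda>i. of_real (sqrt (s 0)) * col U 0 i))\<^sup>2"
    by (simp add: vnorm_sq half_factor_def col_def mult.commute)
  also have "\<dots> = s 0"
    using assms by (simp add: vnorm_scale vnorm_col[OF U])
  finally have "sqrt (\<Sum>i<n. (cmod (\<Sum>j<r. ?A i j * e j))\<^sup>2) = sqrt (s 0)" by simp
  moreover have "(\<Sum>j<r. (cmod (e j))\<^sup>2) \<le> 1"
  proof -
    have "(\<Sum>j<r. (cmod (e j))\<^sup>2) = (\<Sum>j<r. if j = 0 then 1 else 0)"
      by (rule sum.cong) (auto simp: e_def)
    then show ?thesis by simp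
  qed
  ultimately have "sqrt (s 0) \<in> ?S" by (metis (mono_tags, lifting) mem_Collect_eq)
  then have "sqrt (s 0) \<le> spec_norm n r ?A"
    unfolding spec_norm_def by (intro cSup_upper bdd_aboveI[OF bound]) auto
  then have "(sqrt (s 0))\<^sup>2 \<le> (spec_norm n r ?A)\<^sup>2"
    using \<open>0 \<le> s 0\<close> by (intro power_mono) auto
  with \<open>0 \<le> s 0\<close> show ?thesis by simp
qed

text \<open>Membership of the aligned true factor in its ball: scaling by the square roots of the
  singular values enlarges a row of \<open>U\<close> by at most \<open>sqrt s\<close>, and the
  unitary \<open>Q\<close> preserves row norms.\<close>

lemma norm2inf_aligned_factor:
  assumes Q: "unitary_mat r Q" and U: "norm2inf n r U \<le> sqrt \<beta>" and "0 \<le> \<beta>"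
    and \<sigma>: "\<And>l. l < r \<Longrightarrow> 0 \<le> \<sigma> l" "\<And>l. l < r \<Longrightarrow> \<sigma> l \<le> s" and "0 \<le> s" and B: "s * \<beta> \<le> B"
  shows "(norm2inf n r (matmul r (half_factor U \<sigma>) Q))\<^sup>2 \<le> B"
  unfolding norm2inf_sq_le_iff
proof (intro conjI allI impI)
  show "0 \<le> B" using B \<open>0 \<le> s\<close> \<open>0 \<le> \<beta>\<close> by (meson mult_nonneg_nonneg order.trans)
  fix i assume i: "i < n"
  have "0 \<le> norm2inf n r U" unfolding norm2inf_def by (rule Max_ge) auto
  then have "(norm2inf n r U)\<^sup>2 \<le> \<beta>"
    using U power_mono[of "norm2inf n r U" "sqrt \<beta>" 2] \<open>0 \<le> \<beta>\<close> by simp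
  with i have row: "(vnorm r (U i))\<^sup>2 \<le> \<beta>" unfolding norm2inf_sq_le_iff by blast
  have "vnorm r (half_factor U \<sigma> i) \<le> vnorm r (\<lambda>l. of_real (sqrt s) * U i l)"
    using \<sigma> \<open>0 \<le> s\<close> by (intro vnorm_mono) (auto simp: half_factor_def norm_mult mult.commute intro!: mult_right_mono)
  also have "\<dots> = sqrt s * vnorm r (U i)" using \<open>0 \<le> s\<close> unfolding vnorm_scale norm_of_real by simp
  finally have "(vnorm r (half_factor U \<sigma> i))\<^sup>2 \<le> (sqrt s * vnorm r (U i))\<^sup>2"
    by (intro power_mono) auto
  also have "\<dots> \<le> s * \<beta>"
    using row \<open>0 \<le> s\<close> by (simp add: power_mult_distrib mult_left_mono)
  also note B
  finally show "(vnorm r (matmul r (half_factor U \<sigma>) Q i))\<^sup>2 \<le> B"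
    by (simp add: vnorm_row_matmul_unitary[OF Q])
qed

lemma dist_factors_le:
  assumes "unitary_mat r Q"
  shows "dist_factors n1 n2 r L R L1 R1 \<le> sqrt ((fro n1 r (\<lambda>i j. L i j - matmul r L1 Q i j))\<^sup>2 +
                (fro n2 r (\<lambda>i j. R i j - matmul r R1 Q i j))\<^sup>2)"
  unfolding dist_factors_def
  by (rule cInf_lower) (use assms in \<open>auto intro!: bdd_belowI[of _ 0]\<close>)

text \<open>The deterministic core. \<open>d \<le> \<sigma> 0 / 2\<close> gives
  \<open>\<sigma> 0 \<le> 2 * \<sigma>0 0\<close>, and the factor 2 in the radii absorbs this loss.
  Truncation costs 5 r d^2 and alignment a factor 3; 15 is rounded up to 16 to have an exact square
  root.\<close>

lemma initialization_distance:
  assumes svd: "is_compact_svd n1 n2 r M U \<sigma> V" and "1 \<le> r"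
    and tsvd: "is_trunc_svd n1 n2 r M0 U0 \<sigma>0 V0"
    and diff: "op_le n1 n2 (\<lambda>i j. M0 i j - M i j) d" and d: "d \<le> \<sigma> 0 / 2"
    and incoh: "norm2inf n1 r U \<le> sqrt \<beta>" "norm2inf n2 r V \<le> sqrt \<beta>" and "0 \<le> \<beta>"
    and projL: "is_proj_rowball n1 r (2 * \<beta> * (spec_norm n1 r (half_factor U0 \<sigma>0))\<^sup>2) (half_factor U0 \<sigma>0) L0"
    and projR: "is_proj_rowball n2 r (2 * \<beta> * (spec_norm n2 r (half_factor V0 \<sigma>0))\<^sup>2) (half_factor V0 \<sigma>0) R0"
  shows "dist_factors n1 n2 r L0 R0 (half_factor U \<sigma>) (half_factor V \<sigma>) \<le> 4 * sqrt (real r) * d / sqrt (\<sigma> (r - 1))"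
proof -
  have U: "orthonormal_cols n1 r U" and V: "orthonormal_cols n2 r V"
    and pos: "\<And>l. l < r \<Longrightarrow> 0 < \<sigma> l" and decr: "\<And>l m. l \<le> m \<Longrightarrow> m < r \<Longrightarrow> \<sigma> m \<le> \<sigma> l"
    and M: "\<forall>i<n1. \<forall>j<n2. M i j = (\<Sum>l<r. U i l * of_real (\<sigma> l) * cnj (V j l))"
    using svd unfolding is_compact_svd_def by blast+
  define k where "k = min n1 n2"
  from tsvd obtain U' s' V' where "r \<le> k" and svd0: "is_svd n1 n2 M0 U' s' V'"
    and U0: "\<And>i l. i < n1 \<Longrightarrow> l < r \<Longrightarrow> U' i l = U0 i l"
    and V0: "\<And>i l. i < n2 \<Longrightarrow> l < r \<Longrightarrow> V' i l = V0 i l"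
    and \<sigma>0: "\<And>l. l < r \<Longrightarrow> \<sigma>0 l = s' l"
    unfolding is_trunc_svd_def k_def by metis
  have U': "orthonormal_cols n1 k U'" and V': "orthonormal_cols n2 k V'"
    and pos': "\<forall>l<k. 0 \<le> s' l" and decr': "\<forall>l m. l \<le> m \<and> m < k \<longrightarrow> s' m \<le> s' l"
    and M0: "\<forall>i<n1. \<forall>j<n2. M0 i j = (\<Sum>l<k. U' i l * of_real (s' l) * cnj (V' j l))"
    using svd0 unfolding is_svd_def k_def Let_def by blast+
  have oU0: "orthonormal_cols n1 r U0"
    by (rule orthonormal_cols_cong[OF orthonormal_cols_mono[OF U' \<open>r \<le> k\<close>] U0])
  have oV0: "orthonormal_cols n2 r V0"
    by (rule orthonormal_cols_cong[OF orthonormal_cols_mono[OF V' \<open>r \<le> k\<close>] V0])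
  have "0 < r" "0 < k" using \<open>1 \<le> r\<close> \<open>r \<le> k\<close> by auto
  have nn: "0 \<le> \<sigma> l" if "l < r" for l using pos[OF that] by simp
  have pos0: "0 \<le> \<sigma>0 l" if "l < r" for l using that \<sigma>0 pos' \<open>r \<le> k\<close> by simp
  have "\<sigma> 0 \<le> s' 0 + d"
    using weyl_top[OF M0 U' V' pos' decr' M U V diff \<open>0 < r\<close> \<open>0 < k\<close>] pos[OF \<open>0 < r\<close>] by simp
  then have top: "\<sigma> 0 \<le> 2 * \<sigma>0 0" using d \<sigma>0 \<open>0 < r\<close> by simp
  define m where "m = \<sigma> (r - 1)"
  have m: "0 < m" "\<And>l. l < r \<Longrightarrow> m \<le> \<sigma> l"
    unfolding m_def using pos decr \<open>0 < r\<close> by auto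
  obtain Q where Q: "unitary_mat r Q" and Qle:
    "m * ((fro n1 r (\<lambda>i a. half_factor U0 \<sigma>0 i a - matmul r (half_factor U \<sigma>) Q i a))\<^sup>2
       + (fro n2 r (\<lambda>j a. half_factor V0 \<sigma>0 j a - matmul r (half_factor V \<sigma>) Q j a))\<^sup>2)
    \<le> 3 * (\<Sum>i<n1. \<Sum>j<n2. (cmod ((\<Sum>l<r. U0 i l * of_real (\<sigma>0 l) * cnj (V0 j l))
              - (\<Sum>l<r. U i l * of_real (\<sigma> l) * cnj (V j l))))\<^sup>2)"
    using svd_factors_procrustes[of n1 r U n2 V U0 V0 \<sigma> \<sigma>0 m] U V oU0 oV0 nn pos0 m by auto
  have "(\<Sum>i<n1. \<Sum>j<n2. (cmod ((\<Sum>l<r. U0 i l * of_real (\<sigma>0 l) * cnj (V0 j l))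
              - (\<Sum>l<r. U i l * of_real (\<sigma> l) * cnj (V j l))))\<^sup>2)
      = (\<Sum>i<n1. \<Sum>j<n2. (cmod ((\<Sum>l<r. U' i l * of_real (s' l) * cnj (V' j l)) - M i j))\<^sup>2)"
    using M by (intro sum.cong refl) (simp add: U0 V0 \<sigma>0)
  also have "\<dots> \<le> 5 * real r * d\<^sup>2"
    by (rule truncation_error_frobenius[OF M0 U' V' pos' decr' M V diff \<open>r \<le> k\<close>])
  finally have frob: "(\<Sum>i<n1. \<Sum>j<n2. (cmod ((\<Sum>l<r. U0 i l * of_real (\<sigma>0 l) * cnj (V0 j l))
              - (\<Sum>l<r. U i l * of_real (\<sigma> l) * cnj (V j l))))\<^sup>2) \<le> 5 * real r * d\<^sup>2" .
  have ball: "\<sigma> 0 * \<beta> \<le> 2 * \<beta> * (spec_norm n r (half_factor W \<sigma>0))\<^sup>2" if "orthonormal_cols n r W" for n W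
  proof -
    have "\<sigma> 0 \<le> 2 * (spec_norm n r (half_factor W \<sigma>0))\<^sup>2"
      using spec_norm_half_factor_ge[OF that \<open>0 < r\<close>, of \<sigma>0] pos0[OF \<open>0 < r\<close>] top by linarith
    from mult_right_mono[OF this \<open>0 \<le> \<beta>\<close>] show ?thesis by (simp add: mult_ac)
  qed
  have inL: "(norm2inf n1 r (matmul r (half_factor U \<sigma>) Q))\<^sup>2 \<le> 2 * \<beta> * (spec_norm n1 r (half_factor U0 \<sigma>0))\<^sup>2"
    using nn decr \<open>0 < r\<close>
    by (intro norm2inf_aligned_factor[OF Q incoh(1) \<open>0 \<le> \<beta>\<close> _ _ _ ball[OF oU0]]) auto
  have inR: "(norm2inf n2 r (matmul r (half_factor V \<sigma>) Q))\<^sup>2 \<le> 2 * \<beta> * (spec_norm n2 r (half_factor V0 \<sigma>0))\<^sup>2"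
    using nn decr \<open>0 < r\<close>
    by (intro norm2inf_aligned_factor[OF Q incoh(2) \<open>0 \<le> \<beta>\<close> _ _ _ ball[OF oV0]]) auto
  define D where "D = (fro n1 r (\<lambda>i a. L0 i a - matmul r (half_factor U \<sigma>) Q i a))\<^sup>2
       + (fro n2 r (\<lambda>j a. R0 j a - matmul r (half_factor V \<sigma>) Q j a))\<^sup>2"
  have "D \<le> (fro n1 r (\<lambda>i a. half_factor U0 \<sigma>0 i a - matmul r (half_factor U \<sigma>) Q i a))\<^sup>2
       + (fro n2 r (\<lambda>j a. half_factor V0 \<sigma>0 j a - matmul r (half_factor V \<sigma>) Q j a))\<^sup>2"
    unfolding D_def by (intro add_mono proj_rowball_nonexpansive[OF projL inL] proj_rowball_nonexpansive[OF projR inR])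
  then have "m * D \<le> m * ((fro n1 r (\<lambda>i a. half_factor U0 \<sigma>0 i a - matmul r (half_factor U \<sigma>) Q i a))\<^sup>2
       + (fro n2 r (\<lambda>j a. half_factor V0 \<sigma>0 j a - matmul r (half_factor V \<sigma>) Q j a))\<^sup>2)"
    using m(1) by (intro mult_left_mono) auto
  also note Qle
  also have "3 * (\<Sum>i<n1. \<Sum>j<n2. (cmod ((\<Sum>l<r. U0 i l * of_real (\<sigma>0 l) * cnj (V0 j l))
              - (\<Sum>l<r. U i l * of_real (\<sigma> l) * cnj (V j l))))\<^sup>2) \<le> 16 * real r * d\<^sup>2"
  proof -
    have "0 \<le> real r * d\<^sup>2" by simp
    with frob show ?thesis by linarith
  qed
  finally have "D \<le> 16 * real r * d\<^sup>2 / m"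
    using m(1) by (simp add: field_simps)
  then have "sqrt D \<le> sqrt (16 * real r * d\<^sup>2 / m)" by simp
  also have "\<dots> = 4 * sqrt (real r) * d / sqrt m"
    using diff by (simp add: real_sqrt_mult real_sqrt_divide op_le_def real_sqrt_abs2)
  finally have "sqrt D \<le> 4 * sqrt (real r) * d / sqrt m" .
  with dist_factors_le[OF Q, of n1 n2 L0 R0 "half_factor U \<sigma>" "half_factor V \<sigma>"] show ?thesis
    unfolding D_def m_def by linarith
qed

section \<open>Hankel matrices and the discrete Fourier transform\<close>

definition dft :: "nat \<Rightarrow> nat \<Rightarrow> nat \<Rightarrow> complex" where
  "dft n i m = cis (2 * pi * real i * real m / real n)"

lemma cmod_dft [simp]: "cmod (dft n i m) = 1"
  by (simp add: dft_def)

lemma dft_add: "dft n (i + j) m = dft n i m * dft n j m"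
  by (simp add: dft_def cis_mult add_divide_distrib algebra_simps)

lemma dft_sym: "dft n i m = dft n m i"
  by (simp add: dft_def mult_ac)

lemma sum_dft:
  assumes "a < n" "b < n"
  shows "(\<Sum>m<n. cnj (dft n m a) * dft n m b) = (if a = b then of_nat n else 0)"
proof (cases "a = b")
  case True
  have "cnj (dft n m b) * dft n m b = 1" for m
    using complex_norm_square[of "dft n m b"] by (simp add: mult.commute)
  with True show ?thesis by simp
next
  case False
  define z where "z = cis (2 * pi * (real b - real a) / real n)"
  have n: "n > 0" using assms by simp
  have "cnj (dft n m a) * dft n m b = z ^ m" for m
    unfolding dft_def z_def cis_cnj cis_mult Complex.DeMoivre
    by (rule arg_cong[of _ _ cis]) (simp add: diff_divide_distrib algebra_simps)
  moreover have "z ^ n = 1"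
  proof -
    have "z ^ n = cis (2 * pi * of_int (int b - int a))"
      unfolding z_def Complex.DeMoivre using n by (intro arg_cong[of _ _ cis]) simp
    also have "\<dots> = 1" by (rule cis_multiple_2pi) simp
    finally show ?thesis .
  qed
  moreover have "z \<noteq> 1"
  proof
    assume "z = 1"
    then have "cos (2 * pi * (real b - real a) / real n) = 1" by (simp add: z_def complex_eq_iff)
    then obtain k :: int where k: "2 * pi * (real b - real a) / real n = of_int k * 2 * pi"
      using cos_one_2pi_int by blast
    then have "(2 * pi) * (real b - real a) = (2 * pi) * (of_int k * real n)" using n by (simp add: field_simps)
    then have "real b - real a = of_int k * real n" by (subst (asm) mult_cancel_left) simp
    then have "of_int (int b - int a) = (of_int (k * int n) :: real)" by simp
    then have eq: "int b - int a = k * int n" unfolding of_int_eq_iff .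
    then have "int n dvd int b - int a" by simp
    moreover have "\<bar>int b - int a\<bar> < int n" using assms by linarith
    ultimately have "int b - int a = 0" using dvd_imp_le_int[of "int b - int a" "int n"] by linarith
    with False show False by simp
  qed
  ultimately show ?thesis using False by (simp add: geometric_sum)
qed

text \<open>Parseval for the unnormalised transform, hence the factor n; dividing by
  \<open>sqrt n\<close> gives a matrix with orthonormal columns.\<close>

lemma vnorm_dft:
  "(vnorm n (\<lambda>m. \<Sum>i<n. dft n m i * u i))\<^sup>2 = real n * (vnorm n u)\<^sup>2"
proof (cases "n = 0")
  case False
  define F where "F = (\<lambda>m i. dft n m i / complex_of_real (sqrt (real n)))"
  have "orthonormal_cols n n F"
    unfolding orthonormal_cols_def
  proof (intro allI impI)
    fix a b assume ab: "a < n" "b < n"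
    have sq: "complex_of_real (sqrt (real n)) * of_real (sqrt (real n)) = of_nat n"
      unfolding of_real_mult[symmetric] by simp
    have "(\<Sum>i<n. cnj (F i a) * F i b) = (\<Sum>i<n. cnj (dft n i a) * dft n i b) / of_nat n"
      by (simp add: F_def sum_divide_distrib sq)
    then show "(\<Sum>i<n. cnj (F i a) * F i b) = (if a = b then 1 else 0)"
      using False unfolding sum_dft[OF ab] by simp
  qed
  then have "vnorm n (mvec n F u) = vnorm n u" by (rule vnorm_mvec_orthonormal)
  moreover have "(\<lambda>m. \<Sum>i<n. dft n m i * u i) = (\<lambda>m. of_real (sqrt (real n)) * mvec n F u m)"
    using False by (simp add: F_def mvec_def sum_distrib_left)
  ultimately show ?thesis
    unfolding \<open>(\<lambda>m. \<Sum>i<n. dft n m i * u i) = _\<close> vnorm_scale by (simp add: power_mult_distrib)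
qed (simp add: vnorm_def)

lemma vnorm_dft_short:
  assumes "k \<le> n"
  shows "vnorm n (\<lambda>m. \<Sum>i<k. dft n i m * u i) = sqrt (real n) * vnorm k u"
proof -
  define w where "w = (\<lambda>i. if i < k then u i else 0)"
  have "(\<Sum>i<k. dft n i m * u i) = (\<Sum>i<n. dft n m i * w i)" for m
    using assms by (intro sum.mono_neutral_cong_left) (auto simp: w_def dft_sym[of n m])
  moreover have "(vnorm n w)\<^sup>2 = (vnorm k u)\<^sup>2"
    unfolding vnorm_sq using assms by (intro sum.mono_neutral_cong_right) (auto simp: w_def)
  ultimately have "(vnorm n (\<lambda>m. \<Sum>i<k. dft n i m * u i))\<^sup>2 = (sqrt (real n) * vnorm k u)\<^sup>2"
    using vnorm_dft[of n w] by (simp add: power_mult_distrib)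
  then show ?thesis by (rule power2_eq_imp_eq) simp_all
qed

lemma dft_inversion:
  assumes "t < n"
  shows "of_nat n * y t = (\<Sum>m<n. dft n t m * (\<Sum>s<n. cnj (dft n s m) * y s))"
proof -
  have "(\<Sum>m<n. dft n t m * (\<Sum>s<n. cnj (dft n s m) * y s))
      = (\<Sum>s<n. (\<Sum>m<n. cnj (dft n m s) * dft n m t) * y s)"
    unfolding sum_distrib_left sum_distrib_right
    by (subst sum.swap) (simp add: dft_sym[of n t] dft_sym[of n _ s for s] mult_ac)
  also have "\<dots> = (\<Sum>s<n. if s = t then of_nat n * y s else 0)"
    using assms by (intro sum.cong) (auto simp: sum_dft)
  finally show ?thesis using assms by simp
qed

text \<open>A Hankel matrix is a sum of rank-one matrices built from the characters of \<open>\<int>/n\<close>, weighted by the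
  discrete Fourier coefficients of its symbol. The wrap-around is harmless because \<open>i + j < n\<close>.\<close>

lemma op_le_hankel:
  assumes n: "n = n1 + n2 - 1" "1 \<le> n1" "1 \<le> n2" and "0 \<le> Y"
    and Y: "\<And>m. m < n \<Longrightarrow> cmod (\<Sum>t<n. cnj (dft n t m) * y t) \<le> Y"
  shows "op_le n1 n2 (hankel y) Y"
proof (rule op_leI[OF \<open>0 \<le> Y\<close>])
  fix u v
  define c where "c = (\<lambda>m. \<Sum>t<n. cnj (dft n t m) * y t)"
  define a where "a = (\<lambda>m. \<Sum>i<n1. dft n i m * cnj (u i))"
  define b where "b = (\<lambda>m. \<Sum>j<n2. dft n j m * v j)"
  have n0: "n > 0" using n by simp
  have "of_nat n * cdot n1 u (mvec n2 (hankel y) v)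
      = (\<Sum>i<n1. \<Sum>j<n2. cnj (u i) * (of_nat n * y (i + j)) * v j)"
    by (simp add: cdot_def mvec_def hankel_def sum_distrib_left mult_ac)
  \<comment> \<open>Inverting the transform at \<open>i + j\<close> and splitting the character
    separates the row index from the column index.\<close>
  also have "\<dots> = (\<Sum>i<n1. \<Sum>j<n2. \<Sum>m<n. c m * (dft n i m * cnj (u i)) * (dft n j m * v j))"
  proof (intro sum.cong refl)
    fix i j assume "i \<in> {..<n1}" "j \<in> {..<n2}"
    then have "i + j < n" using n by auto
    then have "of_nat n * y (i + j) = (\<Sum>m<n. dft n i m * dft n j m * c m)"
      unfolding c_def dft_add[symmetric] by (rule dft_inversion)
    then show "cnj (u i) * (of_nat n * y (i + j)) * v j
        = (\<Sum>m<n. c m * (dft n i m * cnj (u i)) * (dft n j m * v j))"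
      by (simp add: sum_distrib_left sum_distrib_right mult_ac)
  qed
  also have "\<dots> = (\<Sum>m<n. \<Sum>i<n1. \<Sum>j<n2. c m * (dft n i m * cnj (u i)) * (dft n j m * v j))"
    by (simp only: sum.swap[of _ "{..<n}"])
  also have "\<dots> = (\<Sum>m<n. c m * (a m * b m))"
    unfolding a_def b_def sum_product by (simp add: sum_distrib_left mult.assoc)
  finally have "real n * cmod (cdot n1 u (mvec n2 (hankel y) v)) = cmod (\<Sum>m<n. c m * (a m * b m))"
    by (metis norm_mult norm_of_nat)
  also have "\<dots> \<le> (\<Sum>m<n. Y * (cmod (a m) * cmod (b m)))"
    using Y by (intro sum_norm_le) (auto simp: norm_mult c_def intro!: mult_right_mono)
  also have "\<dots> = Y * (\<Sum>m<n. cmod (a m) * cmod (b m))"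
    by (simp add: sum_distrib_left)
  also have "\<dots> \<le> Y * (vnorm n a * vnorm n b)"
    using \<open>0 \<le> Y\<close> by (intro mult_left_mono sum_cmod_mult_le)
  also have "vnorm n a = sqrt (real n) * vnorm n1 u"
    unfolding a_def using n by (subst vnorm_dft_short) auto
  also have "vnorm n b = sqrt (real n) * vnorm n2 v"
    unfolding b_def using n by (subst vnorm_dft_short) auto
  \<comment> \<open>The two factors \<open>sqrt n\<close> from Parseval cancel the n on the left, so
    the norm bound carries no dimension factor.\<close>
  also have "Y * (sqrt (real n) * vnorm n1 u * (sqrt (real n) * vnorm n2 v))
      = real n * (Y * vnorm n1 u * vnorm n2 v)"
    using real_sqrt_mult_self[of "real n"] by (simp add: mult_ac)
  finally show "cmod (cdot n1 u (mvec n2 (hankel y) v)) \<le> Y * vnorm n1 u * vnorm n2 v"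
    using n0 by simp
qed

lemma op_le_sparse_hankel:
  assumes n: "n = n1 + n2 - 1" "1 \<le> n1" "1 \<le> n2" and "finite S" and "0 \<le> c"
    and S: "\<And>t. t < n \<Longrightarrow> t \<notin> S \<Longrightarrow> e t = 0" and c: "\<And>t. t < n \<Longrightarrow> cmod (e t) \<le> c"
  shows "op_le n1 n2 (hankel e) (real (card S) * c)"
proof (rule op_le_hankel[OF n])
  show "0 \<le> real (card S) * c" using \<open>0 \<le> c\<close> by simp
  fix m assume "m < n"
  have "(\<Sum>t<n. cnj (dft n t m) * e t) = (\<Sum>t\<in>{..<n} \<inter> S. cnj (dft n t m) * e t)"
    by (intro sum.mono_neutral_cong_right) (auto simp: S)
  also have "cmod \<dots> \<le> (\<Sum>t\<in>{..<n} \<inter> S. c)"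
    by (rule sum_norm_le) (auto simp: norm_mult c)
  also have "\<dots> \<le> real (card S) * c"
    using \<open>finite S\<close> \<open>0 \<le> c\<close> by (simp add: mult_right_mono card_mono)
  finally show "cmod (\<Sum>t<n. cnj (dft n t m) * e t) \<le> real (card S) * c" .
qed

text \<open>Hard thresholding of \<open>a + b\<close> with \<open>b\<close> sparse: an entry of \<open>b\<close> that is not selected is dominated by a
  selected entry outside the support of \<open>b\<close>.\<close>

lemma thresholding_error:
  assumes G: "is_Gamma n k y w" and y: "\<And>i. i < n \<Longrightarrow> y i = a i + b i"
    and a: "\<And>i. i < n \<Longrightarrow> cmod (a i) \<le> c" and b: "card {i. i < n \<and> b i \<noteq> 0} \<le> k"
  shows "\<exists>S. finite S \<and> card S \<le> 2 * k \<and> (\<forall>i<n. i \<notin> S \<longrightarrow> b i - w i = 0)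
           \<and> (\<forall>i<n. cmod (b i - w i) \<le> 2 * c)"
proof -
  define B where "B = {i. i < n \<and> b i \<noteq> 0}"
  from G obtain T where T: "T \<subseteq> {..<n}" "card T = min k n"
    and dom: "\<And>i j. i \<in> T \<Longrightarrow> j < n \<Longrightarrow> j \<notin> T \<Longrightarrow> cmod (y j) \<le> cmod (y i)"
    and w: "\<And>i. i < n \<Longrightarrow> w i = (if i \<in> T then y i else 0)"
    unfolding is_Gamma_def by blast
  have fin: "finite T" "finite B" using T(1) by (auto simp: B_def intro: finite_subset)
  have "card (T \<union> B) \<le> 2 * k"
    using card_Un_le[of T B] T(2) b unfolding B_def by linarith
  moreover have "b i - w i = 0" if "i < n" "i \<notin> T \<union> B" for i
    using that w by (simp add: B_def)
  moreover have "cmod (b i - w i) \<le> 2 * c" if i: "i < n" for i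
  proof -
    have c: "0 \<le> c" using a[OF i] norm_ge_zero order.trans by blast
    consider "i \<in> T" | "i \<notin> T" "i \<notin> B" | "i \<notin> T" "i \<in> B" by blast
    then show ?thesis
    proof cases
      case 1
      then have "b i - w i = - a i" using w[OF i] y[OF i] by simp
      with a[OF i] c show ?thesis by simp
    next
      case 2
      with i w[OF i] c show ?thesis by (simp add: B_def)
    next
      case 3
      \<comment> \<open>Leaving out \<open>i\<close> makes the support of \<open>b\<close> strictly
        smaller than the selection, so a selected index outside that support exists. For
        \<open>k \<ge> n\<close> the selection is everything and contains \<open>i\<close>, a
        contradiction.\<close>
      have "card (B - {i}) < card T"
      proof (cases "k < n")
        case True
        have "card (B - {i}) < card B" using 3 fin by (intro psubset_card_mono) auto
        with b T(2) True show ?thesis unfolding B_def by simp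
      next
        case False
        then have "T = {..<n}" using T by (intro card_subset_eq) auto
        with 3 i show ?thesis by simp
      qed
      then have "\<not> T \<subseteq> B - {i}" using fin card_mono[of "B - {i}" T] by fastforce
      then obtain j where j: "j \<in> T" "j \<notin> B" using 3 by blast
      then have "j < n" using T(1) by auto
      have "cmod (y i) \<le> cmod (y j)" using dom[OF j(1) i 3(1)] .
      also have "y j = a j" using j \<open>j < n\<close> y by (simp add: B_def)
      finally have "cmod (y i) \<le> c" using a[OF \<open>j < n\<close>] by simp
      moreover have "b i - w i = y i - a i" using w[OF i] y[OF i] 3 by simp
      ultimately show ?thesis using a[OF i] norm_triangle_ineq4[of "y i" "a i"] by simp
    qed
  qed
  ultimately show ?thesis using fin by (intro exI[of _ "T \<union> B"]) auto
qed

text \<open>Makes the reweighting invertible on the indices below n, so that it cancels in the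
  Hankel lift.\<close>

lemma varsigma_pos:
  assumes "t < n1 + n2 - 1" "1 \<le> n1" "1 \<le> n2"
  shows "0 < varsigma n1 n2 t"
proof -
  have "(min t (n1 - 1), t - min t (n1 - 1)) \<in> {(i, j). i < n1 \<and> j < n2 \<and> i + j = t}"
    using assms by (auto simp: min_def)
  moreover have "finite {(i, j). i < n1 \<and> j < n2 \<and> i + j = t}"
    by (rule finite_subset[of _ "{..<n1} \<times> {..<n2}"]) auto
  ultimately show ?thesis unfolding varsigma_def card_gt_0_iff by blast
qed

section \<open>Concentration for Bernoulli sampling\<close>

text \<open>For negative x the gap between the two sides decreases on [x, 0] to its value 0 at the
  origin, since 1 + 2 y - exp y \<le> y \<le> 0.\<close>

lemma exp_le_quadratic:
  fixes x :: real
  assumes "x \<le> 1"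
  shows "exp x \<le> 1 + x + x\<^sup>2"
proof (cases "0 \<le> x")
  case True
  with assms show ?thesis by (intro exp_bound)
next
  case False
  define f where "f = (\<lambda>x::real. (1 + x + x\<^sup>2) - exp x)"
  have "\<exists>d. (f has_real_derivative d) (at y) \<and> d \<le> 0" if "x \<le> y" "y \<le> 0" for y
  proof (intro exI[of _ "1 + 2 * y - exp y"] conjI)
    show "(f has_real_derivative 1 + 2 * y - exp y) (at y)"
      unfolding f_def by (auto intro!: derivative_eq_intros)
    show "1 + 2 * y - exp y \<le> 0" using exp_ge_add_one_self[of y] that by linarith
  qed
  with False have "f 0 \<le> f x"
    by (intro DERIV_nonpos_imp_nonincreasing[of x 0 f]) simp_all
  then show ?thesis by (simp add: f_def)
qed

text \<open>The condition on \<open>x\<close> keeps the exponent below 1 for both outcomes, so the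
  quadratic bound on exp applies; centring cancels the linear terms and the variance (1/p - 1) x^2
  remains.\<close>

lemma bernoulli_centred_mgf:
  assumes p: "0 < p" "p \<le> 1" and x: "\<bar>x\<bar> \<le> p"
  shows "measure_pmf.expectation (bernoulli_pmf p) (\<lambda>b. exp (((if b then 1 / p else 0) - 1) * x)) \<le> exp (x\<^sup>2 / p)"
proof -
  have "measure_pmf.expectation (bernoulli_pmf p) (\<lambda>b. exp (((if b then 1 / p else 0) - 1) * x))
      = p * exp ((1 / p - 1) * x) + (1 - p) * exp (- x)"
    using p by simp
  also have "\<dots> \<le> p * (1 + (1 / p - 1) * x + ((1 / p - 1) * x)\<^sup>2) + (1 - p) * (1 + - x + (- x)\<^sup>2)"
  proof (intro add_mono mult_left_mono exp_le_quadratic)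
    have "(1 / p - 1) * x \<le> \<bar>(1 / p - 1) * x\<bar>" by simp
    also have "\<dots> = (1 / p - 1) * \<bar>x\<bar>" using p by (simp add: abs_mult)
    also have "\<dots> \<le> (1 / p - 1) * p" using p x by (intro mult_left_mono) auto
    also have "\<dots> \<le> 1" using p by (simp add: field_simps)
    finally show "(1 / p - 1) * x \<le> 1" .
    show "- x \<le> 1" using p x by linarith
  qed (use p in auto)
  also have "\<dots> = 1 + (1 / p - 1) * x\<^sup>2"
    using p by (simp add: power2_eq_square field_simps)
  also have "\<dots> \<le> 1 + x\<^sup>2 / p" using p by (simp add: field_simps)
  also have "\<dots> \<le> exp (x\<^sup>2 / p)" by (rule exp_ge_add_one_self)
  finally show ?thesis .
qed

text \<open>Chernoff bound with the parameter \<theta> left free;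
  \<open>\<theta> * K \<le> p\<close> places every summand in the range of the moment bound.\<close>

lemma bernoulli_sum_tail:
  fixes a :: "nat \<Rightarrow> real"
  assumes p: "0 < p" "p \<le> 1" and K: "\<And>t. t < n \<Longrightarrow> \<bar>a t\<bar> \<le> K" and W: "(\<Sum>t<n. (a t)\<^sup>2) \<le> W"
    and \<theta>: "0 \<le> \<theta>" "\<theta> * K \<le> p"
  shows "measure_pmf.prob (Pi_pmf {..<n} False (\<lambda>_. bernoulli_pmf p))
      {b. \<tau> \<le> (\<Sum>t<n. ((if b t then 1 / p else 0) - 1) * a t)} \<le> exp (\<theta>\<^sup>2 * W / p - \<theta> * \<tau>)"
proof -
  let ?P = "Pi_pmf {..<n} False (\<lambda>_. bernoulli_pmf p)"
  let ?X = "\<lambda>b. \<Sum>t<n. ((if b t then 1 / p else 0) - 1) * a t"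
  let ?f = "\<lambda>t b. exp (((if b then 1 / p else 0) - 1) * (\<theta> * a t))"
  have fin: "finite (set_pmf ?P)"
    by (rule finite_subset[OF set_Pi_pmf_subset'])
       (auto intro!: finite_PiE_dflt)
  have "measure_pmf.prob ?P {b. \<tau> \<le> ?X b} \<le> measure_pmf.prob ?P {b. exp (\<theta> * \<tau>) \<le> exp (\<theta> * ?X b)}"
    using \<theta>(1) by (intro measure_pmf.finite_measure_mono) (auto intro: mult_left_mono)
  also have "\<dots> \<le> measure_pmf.expectation ?P (\<lambda>b. exp (\<theta> * ?X b)) / exp (\<theta> * \<tau>)"
    using integral_Markov_inequality_measure[OF integrable_measure_pmf_finite[OF fin],
        of UNIV "\<lambda>b. exp (\<theta> * ?X b)" "exp (\<theta> * \<tau>)"] by simp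
  also have "(\<lambda>b. exp (\<theta> * ?X b)) = (\<lambda>b. \<Prod>t<n. ?f t (b t))"
    by (simp add: exp_sum sum_distrib_left mult_ac)
  also have "measure_pmf.expectation ?P (\<lambda>b. \<Prod>t<n. ?f t (b t))
      = (\<Prod>t<n. measure_pmf.expectation (bernoulli_pmf p) (?f t))"
    by (rule expectation_prod_Pi_pmf) (auto intro: integrable_measure_pmf_finite)
  also have "\<dots> \<le> (\<Prod>t<n. exp ((\<theta> * a t)\<^sup>2 / p))"
  proof (intro prod_mono conjI bernoulli_centred_mgf p)
    fix t assume "t \<in> {..<n}"
    then have "\<theta> * \<bar>a t\<bar> \<le> \<theta> * K" using K \<theta>(1) by (intro mult_left_mono) auto
    then show "\<bar>\<theta> * a t\<bar> \<le> p" using \<theta> by (simp add: abs_mult)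
  qed (auto intro: Bochner_Integration.integral_nonneg)
  also have "\<dots> = exp (\<theta>\<^sup>2 * (\<Sum>t<n. (a t)\<^sup>2) / p)"
    by (simp add: exp_sum[symmetric] power_mult_distrib sum_distrib_left sum_divide_distrib)
  also have "\<dots> \<le> exp (\<theta>\<^sup>2 * W / p)"
    using p W by (simp add: divide_right_mono mult_left_mono)
  finally show ?thesis by (simp add: exp_diff divide_right_mono)
qed

text \<open>Each complex coefficient is controlled through its real and imaginary parts with both
  signs, each at level \<tau>. This accounts for the 4 n events of the union bound and for the level
  2 \<tau>.\<close>

lemma bernoulli_transform_tail:
  fixes c :: "nat \<Rightarrow> nat \<Rightarrow> complex" and x :: "nat \<Rightarrow> complex"
  assumes p: "0 < p" "p \<le> 1" and K: "\<And>t. t < n \<Longrightarrow> cmod (x t) \<le> K" and W: "(\<Sum>t<n. (cmod (x t))\<^sup>2) \<le> W"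
    and \<theta>: "0 \<le> \<theta>" "\<theta> * K \<le> p" and c: "\<And>m t. cmod (c m t) \<le> 1"
  shows "1 - 4 * real n * exp (\<theta>\<^sup>2 * W / p - \<theta> * \<tau>) \<le> measure_pmf.prob (Pi_pmf {..<n} False (\<lambda>_. bernoulli_pmf p))
      {b. \<forall>m<n. cmod (\<Sum>t<n. c m t * (of_real ((if b t then 1 / p else 0) - 1) * x t)) \<le> 2 * \<tau>}"
proof -
  let ?P = "measure_pmf (Pi_pmf {..<n} False (\<lambda>_. bernoulli_pmf p))"
  let ?q = "exp (\<theta>\<^sup>2 * W / p - \<theta> * \<tau>)"
  define S where "S = (\<lambda>b (a::nat \<Rightarrow> real). \<Sum>t<n. ((if b t then 1 / p else 0) - 1) * a t)"
  define A where "A = (\<lambda>k m t. if k = 0 then Re (c m t * x t) else if k = 1 then - Re (c m t * x t)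
      else if k = (2::nat) then Im (c m t * x t) else - Im (c m t * x t))"
  define Bad where "Bad = (\<Union>(k,m)\<in>{..<4}\<times>{..<n}. {b. \<tau> \<le> S b (A k m)})"
  have cx: "cmod (c m t * x t) \<le> cmod (x t)" for m t
    using c[of m t] by (simp add: norm_mult mult_left_le_one_le)
  have A: "\<bar>A k m t\<bar> \<le> cmod (x t)" for k m t
    using cx[of m t] abs_Re_le_cmod[of "c m t * x t"] abs_Im_le_cmod[of "c m t * x t"]
    unfolding A_def by auto
  have tail: "measure ?P {b. \<tau> \<le> S b (A k m)} \<le> ?q" for k m
    unfolding S_def
  proof (rule bernoulli_sum_tail[OF p _ _ \<theta>])
    show "\<bar>A k m t\<bar> \<le> K" if "t < n" for t using A[of k m t] K[OF that] by linarith
    have "(\<Sum>t<n. (A k m t)\<^sup>2) \<le> (\<Sum>t<n. (cmod (x t))\<^sup>2)"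
      using A by (intro sum_mono) (metis abs_ge_zero power2_abs power_mono)
    with W show "(\<Sum>t<n. (A k m t)\<^sup>2) \<le> W" by linarith
  qed
  have "measure ?P Bad \<le> (\<Sum>(k,m)\<in>{..<4}\<times>{..<n}. measure ?P {b. \<tau> \<le> S b (A k m)})"
    unfolding Bad_def
    using measure_pmf.finite_measure_subadditive_finite[of "{..<4}\<times>{..<n}" "\<lambda>(k,m). {b. \<tau> \<le> S b (A k m)}"
        "Pi_pmf {..<n} False (\<lambda>_. bernoulli_pmf p)"]
    by (simp add: case_prod_unfold)
  also have "\<dots> \<le> (\<Sum>(k::nat,m::nat)\<in>{..<4}\<times>{..<n}. ?q)"
    using tail by (intro sum_mono) auto
  also have "\<dots> = 4 * real n * ?q" by simp
  finally have "1 - 4 * real n * ?q \<le> measure ?P (- Bad)"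
    using measure_pmf.prob_compl[of Bad "Pi_pmf {..<n} False (\<lambda>_. bernoulli_pmf p)"]
    by (simp add: Compl_eq_Diff_UNIV)
  also have "\<dots> \<le> measure ?P {b. \<forall>m<n. cmod (\<Sum>t<n. c m t * (of_real ((if b t then 1 / p else 0) - 1) * x t)) \<le> 2 * \<tau>}"
  proof (intro measure_pmf.finite_measure_mono subsetI CollectI allI impI)
    fix b m assume b: "b \<in> - Bad" and m: "m < n"
    let ?z = "\<Sum>t<n. c m t * (of_real ((if b t then 1 / p else 0) - 1) * x t)"
    have good: "S b (A k m) < \<tau>" if "k < 4" for k
    proof (rule ccontr)
      assume "\<not> ?thesis"
      then have "b \<in> Bad" unfolding Bad_def using that m by (intro UN_I[of "(k, m)"]) auto
      with b show False by simp
    qed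
    have z: "?z = (\<Sum>t<n. of_real ((if b t then 1 / p else 0) - 1) * (c m t * x t))"
      by (simp add: mult_ac)
    have "Re (of_real a * w) = a * Re w" "Im (of_real a * w) = a * Im w" for a w by simp_all
    then have "Re ?z = (\<Sum>t<n. ((if b t then 1 / p else 0) - 1) * Re (c m t * x t))"
      "Im ?z = (\<Sum>t<n. ((if b t then 1 / p else 0) - 1) * Im (c m t * x t))"
      unfolding z Re_sum Im_sum by simp_all
    then have "Re ?z = S b (A 0 m)" "- Re ?z = S b (A 1 m)" "Im ?z = S b (A 2 m)" "- Im ?z = S b (A 3 m)"
      unfolding S_def A_def by (simp_all del: times_complex.sel flip: sum_negf)
    then have "\<bar>Re ?z\<bar> \<le> \<tau>" "\<bar>Im ?z\<bar> \<le> \<tau>"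
      using good[of 0] good[of 1] good[of 2] good[of 3] by linarith+
    then show "cmod ?z \<le> 2 * \<tau>" using cmod_le[of ?z] by linarith
  qed simp
  finally show ?thesis .
qed

section \<open>The initialization\<close>

lemma norm2inf_row:
  assumes "norm2inf a b L \<le> sqrt \<beta>" "i < a"
  shows "vnorm b (L i) \<le> sqrt \<beta>"
proof -
  have "vnorm b (L i) \<le> norm2inf a b L"
    unfolding norm2inf_def vnorm_def using assms(2) by (intro Max_ge) auto
  with assms(1) show ?thesis by simp
qed

text \<open>Every \<open>x t\<close> is a matrix entry, hence an inner product of a row of
  \<open>U\<close> and a row of \<open>V\<close> weighted by singular values. An entire row of the
  matrix is, up to conjugation, \<open>V\<close> applied to a weighted row of \<open>U\<close>, and
  orthonormal columns preserve the norm.\<close>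

lemma incoherent_hankel_bounds:
  assumes svd: "is_compact_svd n1 n2 r (hankel x) U \<sigma> V" and "1 \<le> r" and "0 \<le> \<beta>"
    and incoh: "norm2inf n1 r U \<le> sqrt \<beta>" "norm2inf n2 r V \<le> sqrt \<beta>"
    and n: "n = n1 + n2 - 1" "1 \<le> n1" "1 \<le> n2"
  shows "t < n \<Longrightarrow> cmod (x t) \<le> \<sigma> 0 * \<beta>"
    and "(\<Sum>t<n. (cmod (x t))\<^sup>2) \<le> 2 * (\<sigma> 0)\<^sup>2 * \<beta>"
proof -
  have U: "orthonormal_cols n1 r U" and V: "orthonormal_cols n2 r V"
    and \<sigma>: "\<And>l. l < r \<Longrightarrow> 0 < \<sigma> l" "\<And>l. l < r \<Longrightarrow> \<sigma> l \<le> \<sigma> 0"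
    and x: "\<And>i j. i < n1 \<Longrightarrow> j < n2 \<Longrightarrow> x (i + j) = (\<Sum>l<r. U i l * of_real (\<sigma> l) * cnj (V j l))"
    using svd unfolding is_compact_svd_def hankel_def by simp_all
  have \<sigma>0: "0 \<le> \<sigma> 0" using \<sigma>(1)[of 0] \<open>1 \<le> r\<close> by simp
  have scaled: "vnorm r (\<lambda>l. of_real (\<sigma> l) * w l) \<le> \<sigma> 0 * vnorm r w" for w
  proof -
    have "vnorm r (\<lambda>l. of_real (\<sigma> l) * w l) \<le> vnorm r (\<lambda>l. of_real (\<sigma> 0) * w l)"
      using \<sigma> \<sigma>0 by (intro vnorm_mono) (auto simp: norm_mult less_imp_le intro!: mult_right_mono)
    then show ?thesis using \<sigma>0 unfolding vnorm_scale norm_of_real by simp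
  qed
  show "cmod (x t) \<le> \<sigma> 0 * \<beta>" if "t < n"
  proof -
    define i where "i = min t (n1 - 1)"
    have ij: "i < n1" "t - i < n2" "t = i + (t - i)" using n that by (auto simp: i_def min_def)
    have "x t = (\<Sum>l<r. (of_real (\<sigma> l) * U i l) * cnj (V (t - i) l))"
      by (subst ij(3), subst x[OF ij(1,2)]) (simp add: mult_ac)
    then have "cmod (x t) \<le> vnorm r (\<lambda>l. of_real (\<sigma> l) * U i l) * vnorm r (V (t - i))"
      using cmod_sum_mult_le[of "\<lambda>l. of_real (\<sigma> l) * U i l" "\<lambda>l. cnj (V (t - i) l)" r] by simp
    also have "\<dots> \<le> (\<sigma> 0 * sqrt \<beta>) * sqrt \<beta>"
      using scaled[of "U i"] norm2inf_row[OF incoh(1) ij(1)] norm2inf_row[OF incoh(2) ij(2)] \<sigma>0 \<open>0 \<le> \<beta>\<close>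
      by (intro mult_mono) (auto intro: order.trans mult_left_mono)
    finally show ?thesis using \<open>0 \<le> \<beta>\<close> by (simp add: mult.assoc)
  qed
  have sq: "(\<sigma> 0 * sqrt \<beta>)\<^sup>2 = (\<sigma> 0)\<^sup>2 * \<beta>" using \<open>0 \<le> \<beta>\<close> by (simp add: power_mult_distrib)
  have bound: "(vnorm r (\<lambda>l. of_real (\<sigma> l) * w l))\<^sup>2 \<le> (\<sigma> 0)\<^sup>2 * \<beta>" if "vnorm r w \<le> sqrt \<beta>" for w
    unfolding sq[symmetric]
    using scaled[of w] mult_left_mono[OF that \<sigma>0] by (intro power_mono) auto
  have row: "(\<Sum>j<n2. (cmod (x j))\<^sup>2) \<le> (\<sigma> 0)\<^sup>2 * \<beta>"
  proof -
    have "cmod (x j) = cmod (mvec r V (\<lambda>l. of_real (\<sigma> l) * cnj (U 0 l)) j)" if "j < n2" for j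
    proof -
      have "x j = cnj (mvec r V (\<lambda>l. of_real (\<sigma> l) * cnj (U 0 l)) j)"
        using x[of 0 j] that n by (simp add: mvec_def mult_ac)
      then show ?thesis by simp
    qed
    then have "(\<Sum>j<n2. (cmod (x j))\<^sup>2) = (vnorm n2 (mvec r V (\<lambda>l. of_real (\<sigma> l) * cnj (U 0 l))))\<^sup>2"
      by (simp add: vnorm_sq)
    also have "\<dots> \<le> (\<sigma> 0)\<^sup>2 * \<beta>"
      unfolding vnorm_mvec_orthonormal[OF V] using norm2inf_row[OF incoh(1), of 0] n
      by (intro bound) simp
    finally show ?thesis .
  qed
  have column: "(\<Sum>i<n1. (cmod (x (i + (n2 - 1))))\<^sup>2) \<le> (\<sigma> 0)\<^sup>2 * \<beta>"
  proof -
    have "x (i + (n2 - 1)) = mvec r U (\<lambda>l. of_real (\<sigma> l) * cnj (V (n2 - 1) l)) i" if "i < n1" for i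
      using x[of i "n2 - 1"] that n by (simp add: mvec_def mult_ac)
    then have "(\<Sum>i<n1. (cmod (x (i + (n2 - 1))))\<^sup>2) = (vnorm n1 (mvec r U (\<lambda>l. of_real (\<sigma> l) * cnj (V (n2 - 1) l))))\<^sup>2"
      by (simp add: vnorm_sq)
    also have "\<dots> \<le> (\<sigma> 0)\<^sup>2 * \<beta>"
      unfolding vnorm_mvec_orthonormal[OF U] using norm2inf_row[OF incoh(2), of "n2 - 1"] n
      by (intro bound) simp
    finally show ?thesis .
  qed
  \<comment> \<open>The two index ranges share n2 - 1, the corner entry; counting it twice only
    enlarges the upper bound.\<close>
  have "{..<n} \<subseteq> {..<n2} \<union> (\<lambda>i. i + (n2 - 1)) ` {..<n1}"
  proof
    fix t assume "t \<in> {..<n}"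
    then show "t \<in> {..<n2} \<union> (\<lambda>i. i + (n2 - 1)) ` {..<n1}"
      using n by (cases "t < n2") (auto intro!: image_eqI[of _ _ "t - (n2 - 1)"])
  qed
  then have "(\<Sum>t<n. (cmod (x t))\<^sup>2) \<le> (\<Sum>t\<in>{..<n2} \<union> (\<lambda>i. i + (n2 - 1)) ` {..<n1}. (cmod (x t))\<^sup>2)"
    by (intro sum_mono2) auto
  also have "\<dots> \<le> (\<Sum>t<n2. (cmod (x t))\<^sup>2) + (\<Sum>t\<in>(\<lambda>i. i + (n2 - 1)) ` {..<n1}. (cmod (x t))\<^sup>2)"
    by (subst sum_Un) (auto intro: sum_nonneg)
  also have "(\<Sum>t\<in>(\<lambda>i. i + (n2 - 1)) ` {..<n1}. (cmod (x t))\<^sup>2) = (\<Sum>i<n1. (cmod (x (i + (n2 - 1))))\<^sup>2)"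
    by (subst sum.reindex) (auto simp: inj_on_def)
  finally show "(\<Sum>t<n. (cmod (x t))\<^sup>2) \<le> 2 * (\<sigma> 0)\<^sup>2 * \<beta>"
    using row column by linarith
qed

text \<open>The symbol of the error is (a / p - x) + (b - w) / p. The first summand is the sampling
  noise. The second has at most 2 \<alpha> p n nonzero entries of modulus at most 2 K / p, so p
  cancels in 4 \<alpha> n K.\<close>

lemma initialization_perturbation:
  fixes n1 n2 :: nat and \<Omega> :: "nat set" and x s :: cvec
  defines "f \<equiv> (\<lambda>k. Dop n1 n2 x k + s k)"
  assumes n: "n = n1 + n2 - 1" "1 \<le> n1" "1 \<le> n2" and p: "0 < p" and "0 \<le> \<alpha>" "0 \<le> K" "0 \<le> Y"
    and sparse: "real (l0 n (PiOm \<Omega> s)) \<le> \<alpha> * p * real n"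
    and K: "\<And>t. t < n \<Longrightarrow> cmod (x t) \<le> K"
    and noise: "\<And>m. m < n \<Longrightarrow> cmod (\<Sum>t<n. cnj (dft n t m) * (of_real ((if t \<in> \<Omega> then 1 / p else 0) - 1) * x t)) \<le> Y"
    and G: "is_Gamma n (nat \<lfloor>\<alpha> * p * real n\<rfloor>) (Dinv n1 n2 (PiOm \<Omega> f)) w"
  shows "op_le n1 n2 (\<lambda>i j. Gop n1 n2 (\<lambda>k. PiOm \<Omega> f k - Dop n1 n2 w k) i j / of_real p - hankel x i j)
           (Y + 4 * \<alpha> * real n * K)"
proof -
  define k where "k = nat \<lfloor>\<alpha> * p * real n\<rfloor>"
  have apn: "0 \<le> \<alpha> * p * real n" using p \<open>0 \<le> \<alpha>\<close> by simp
  then have k: "real k \<le> \<alpha> * p * real n" by (simp add: k_def)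
  define b where "b = Dinv n1 n2 (PiOm \<Omega> s)"
  define a where "a = PiOm \<Omega> x"
  have pos: "complex_of_real (sqrt (real (varsigma n1 n2 t))) \<noteq> 0" if "t < n" for t
    using varsigma_pos[of t n1 n2] that n by simp
  have y: "Dinv n1 n2 (PiOm \<Omega> f) t = a t + b t" if "t < n" for t
    using pos[OF that] by (simp add: Dinv_def PiOm_def f_def Dop_def a_def b_def add_divide_distrib)
  have "{i. i < n \<and> b i \<noteq> 0} = {i. i < n \<and> PiOm \<Omega> s i \<noteq> 0}"
    using pos by (auto simp: b_def Dinv_def)
  then have "card {i. i < n \<and> b i \<noteq> 0} \<le> k"
    using sparse apn unfolding k_def l0_def by (simp add: le_nat_floor)
  moreover have "cmod (a t) \<le> K" if "t < n" for t
    using K[OF that] \<open>0 \<le> K\<close> by (simp add: a_def PiOm_def)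
  ultimately obtain S where S: "finite S" "card S \<le> 2 * k" "\<And>t. t < n \<Longrightarrow> t \<notin> S \<Longrightarrow> b t - w t = 0"
    "\<And>t. t < n \<Longrightarrow> cmod (b t - w t) \<le> 2 * K"
    using thresholding_error[OF G[folded k_def] y, of K] by blast
  define e where "e = (\<lambda>t. (b t - w t) / of_real p)"
  define z where "z = (\<lambda>t. of_real ((if t \<in> \<Omega> then 1 / p else 0) - 1) * x t)"
  have "op_le n1 n2 (hankel e) (real (card S) * (2 * K / p))"
    using S p \<open>0 \<le> K\<close>
    by (intro op_le_sparse_hankel[OF n S(1)]) (auto simp: e_def norm_divide divide_right_mono)
  moreover have "real (card S) * (2 * K / p) \<le> 4 * \<alpha> * real n * K"
  proof -
    have "real (card S) \<le> 2 * (\<alpha> * p * real n)" using S(2) k by linarith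
    then have "real (card S) * (2 * K / p) \<le> 2 * (\<alpha> * p * real n) * (2 * K / p)"
      using p \<open>0 \<le> K\<close> by (intro mult_right_mono) auto
    also have "\<dots> = 4 * \<alpha> * real n * K" using p by simp
    finally show ?thesis .
  qed
  ultimately have "op_le n1 n2 (hankel e) (4 * \<alpha> * real n * K)" by (rule op_le_mono)
  moreover have "op_le n1 n2 (hankel z) Y"
    unfolding z_def by (rule op_le_hankel[OF n \<open>0 \<le> Y\<close> noise])
  ultimately have "op_le n1 n2 (\<lambda>i j. hankel z i j + hankel e i j) (Y + 4 * \<alpha> * real n * K)"
    by (intro op_le_add)
  then show ?thesis
  proof (rule op_le_cong)
    fix i j assume "i < n1" "j < n2"
    then have ij: "i + j < n" using n by simp
    have "Gop n1 n2 (\<lambda>k. PiOm \<Omega> f k - Dop n1 n2 w k) i j = Dinv n1 n2 (PiOm \<Omega> f) (i + j) - w (i + j)"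
      using pos[OF ij] by (simp add: Gop_def hankel_def Dinv_def Dop_def diff_divide_distrib)
    then have "Gop n1 n2 (\<lambda>k. PiOm \<Omega> f k - Dop n1 n2 w k) i j / of_real p = a (i + j) / of_real p + e (i + j)"
      by (simp add: y[OF ij] e_def add_divide_distrib diff_divide_distrib)
    moreover have "a (i + j) / of_real p - x (i + j) = z (i + j)"
      by (simp add: a_def PiOm_def z_def algebra_simps)
    ultimately show "hankel z i j + hankel e i j
        = Gop n1 n2 (\<lambda>k. PiOm \<Omega> f k - Dop n1 n2 w k) i j / of_real p - hankel x i j"
      by (simp add: hankel_def algebra_simps)
  qed
qed

text \<open>For \<open>\<beta> \<le> 0\<close> also \<open>sqrt \<beta> \<le> 0\<close>, so all rows
  of \<open>U\<close> would vanish, against a column of norm one. This yields the positivity on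
  which the later divisions rely.\<close>

lemma incoherence_pos:
  assumes "orthonormal_cols n r U" "1 \<le> r" "norm2inf n r U \<le> sqrt \<beta>"
  shows "0 < \<beta>"
proof (rule ccontr)
  assume "\<not> 0 < \<beta>"
  then have "sqrt \<beta> \<le> 0" by simp
  have "U i 0 = 0" if "i < n" for i
  proof -
    have "vnorm r (U i) = 0"
      using norm2inf_row[OF assms(3) that] \<open>sqrt \<beta> \<le> 0\<close> vnorm_nonneg[of r "U i"] by linarith
    with assms(2) show ?thesis by (simp add: vnorm_eq_0_iff)
  qed
  then have "vnorm n (col U 0) = 0" by (simp add: vnorm_eq_0_iff col_def)
  with vnorm_col[OF assms(1), of 0] assms(2) show False by simp
qed

text \<open>The exponent 9/2 is relaxed to 4, and 4 n / n^4 = 4 / n^3 \<le> 2 / n^2 because n is at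
  least 2.\<close>

lemma failure_probability_le:
  fixes q :: real
  assumes "2 \<le> n" "q \<le> exp (- (9 / 2) * ln (real n))"
  shows "4 * real n * q \<le> 2 / (real n)\<^sup>2"
proof -
  have n: "real n \<ge> 2" using assms(1) by simp
  have "q \<le> exp (- (4 * ln (real n)))"
    using assms(2) n by (elim order.trans) simp
  also have "\<dots> = 1 / real n ^ 4"
    using n exp_of_nat_mult[of 4 "ln (real n)"] by (simp add: exp_minus inverse_eq_divide)
  finally have "4 * real n * q \<le> 4 * real n * (1 / real n ^ 4)"
    using n by (intro mult_left_mono) auto
  also have "\<dots> = 4 / (real n * (real n)\<^sup>2)"
    using n by (simp add: field_simps power2_eq_square power4_eq_xxxx)
  also have "\<dots> \<le> 4 / (2 * (real n)\<^sup>2)"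
    using n by (intro divide_left_mono mult_right_mono mult_pos_pos) auto
  finally show ?thesis by simp
qed

lemma initialization_probability:
  fixes n1 n2 r n :: nat and \<mu> \<alpha> p \<epsilon>0 cs \<kappa> \<sigma>r :: real and x s f :: cvec
  assumes n_def: "n = n1 + n2 - 1" and cs_def: "cs = max (real n / real n1) (real n / real n2)"
    and \<kappa>_def: "\<kappa> = \<sigma> 0 / \<sigma> (r - 1)" and \<sigma>r_def: "\<sigma>r = \<sigma> (r - 1)"
    and f_def: "f = (\<lambda>k. Dop n1 n2 x k + s k)"
    and n1: "1 \<le> n1" and n2: "1 \<le> n2" and r: "1 \<le> r"
    and svd: "is_compact_svd n1 n2 r (hankel x) U \<sigma> V"
    and incohU: "norm2inf n1 r U \<le> sqrt (\<mu> * cs * real r / real n)"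
    and incohV: "norm2inf n2 r V \<le> sqrt (\<mu> * cs * real r / real n)"
    and \<alpha>: "0 \<le> \<alpha>" "\<alpha> \<le> 1 / (32 * cs * \<mu> * real r * \<kappa>)"
    and p1: "p \<le> 1"
    and p_ge: "p \<ge> (\<epsilon>0 powr (-2) * \<kappa> ^ 3 * cs * \<mu> * (real r) ^ 2 * ln (real n)) / real n"
    and \<epsilon>0: "0 < \<epsilon>0" "\<epsilon>0 < sqrt (\<kappa> * real r) / (8 * 12)"
  shows "measure_pmf.prob (bernoulli_set_pmf n p)
      {\<Omega>. real (l0 n (PiOm \<Omega> s)) \<le> \<alpha> * p * real n \<longrightarrow>
         (\<forall>w s0 U0 \<sigma>0 V0 L0 R0.
            is_Gamma n (nat \<lfloor>\<alpha> * p * real n\<rfloor>) (Dinv n1 n2 (PiOm \<Omega> f)) w \<and>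
            s0 = Dop n1 n2 w \<and>
            is_trunc_svd n1 n2 r
              (\<lambda>i j. Gop n1 n2 (\<lambda>k. PiOm \<Omega> f k - s0 k) i j / complex_of_real p) U0 \<sigma>0 V0 \<and>
            is_proj_rowball n1 r (2 * \<mu> * real r * cs / real n * (spec_norm n1 r (half_factor U0 \<sigma>0))\<^sup>2)
              (half_factor U0 \<sigma>0) L0 \<and>
            is_proj_rowball n2 r (2 * \<mu> * real r * cs / real n * (spec_norm n2 r (half_factor V0 \<sigma>0))\<^sup>2)
              (half_factor V0 \<sigma>0) R0
          \<longrightarrow> dist_factors n1 n2 r L0 R0 (half_factor U \<sigma>) (half_factor V \<sigma>)
              \<le> 26 * \<alpha> * cs * \<kappa> * \<mu> * real r * sqrt (real r) * sqrt \<sigma>r + 7 * 12 * \<epsilon>0 * sqrt (\<sigma>r / \<kappa>))}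
      \<ge> 1 - 2 / (real n)\<^sup>2" (is "measure_pmf.prob _ ?Good \<ge> _")
proof (cases "2 \<le> n")
  case False
  \<comment> \<open>Here the claimed probability is negative, whereas ln n = 0 would leave p without
    a positive lower bound.\<close>
  then have "real n = 1" using n1 n2 n_def by simp
  then have "1 - 2 / (real n)\<^sup>2 \<le> 0" by simp
  then show ?thesis using measure_nonneg order.trans by blast
next
  case True
  define \<beta> where "\<beta> = \<mu> * cs * real r / real n"
  have U: "orthonormal_cols n1 r U" and \<sigma>: "\<And>l. l < r \<Longrightarrow> 0 < \<sigma> l" "\<And>l. l < r \<Longrightarrow> \<sigma> l \<le> \<sigma> 0"
    using svd unfolding is_compact_svd_def by simp_all
  have \<beta>: "0 < \<beta>" using incoherence_pos[OF U r incohU] by (simp add: \<beta>_def)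
  have \<sigma>r: "0 < \<sigma>r" and \<sigma>0: "\<sigma> 0 = \<kappa> * \<sigma>r" and \<kappa>: "1 \<le> \<kappa>"
    using \<sigma>[of "r - 1"] r by (simp_all add: \<sigma>r_def \<kappa>_def)
  have r0: "0 < real r" and n0: "0 < real n" and ln: "0 < ln (real n)"
    using r True by auto
  have csr: "cs * \<mu> * real r = \<beta> * real n" using n0 by (simp add: \<beta>_def)
  have \<epsilon>sq: "\<epsilon>0 powr (-2) = 1 / \<epsilon>0\<^sup>2"
    using \<epsilon>0(1) by (simp add: powr_minus inverse_eq_divide)
  have "\<epsilon>0 powr (-2) * \<kappa> ^ 3 * cs * \<mu> * (real r) ^ 2 * ln (real n) / real n
      = \<kappa> ^ 3 * (cs * \<mu> * real r) * real r * ln (real n) / (\<epsilon>0\<^sup>2 * real n)"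
    unfolding \<epsilon>sq by (simp add: power2_eq_square mult_ac)
  also have "\<dots> = \<kappa> ^ 3 * \<beta> * real r * ln (real n) / \<epsilon>0\<^sup>2"
    unfolding csr using n0 by simp
  finally have p_ge': "\<kappa> ^ 3 * \<beta> * real r * ln (real n) / \<epsilon>0\<^sup>2 \<le> p" using p_ge by simp
  have "0 < \<kappa> ^ 3 * \<beta> * real r * ln (real n) / \<epsilon>0\<^sup>2"
    using \<kappa> \<beta> r0 ln \<epsilon>0(1) by simp
  with p_ge' have p: "0 < p" by linarith
  define q where "q = sqrt (\<kappa> * real r)"
  have q: "0 < q" "q\<^sup>2 = \<kappa> * real r" using \<kappa> r0 by (simp_all add: q_def)
  define K where "K = \<sigma> 0 * \<beta>"
  define W where "W = 2 * (\<sigma> 0)\<^sup>2 * \<beta>"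
  \<comment> \<open>Dividing by q = sqrt (\<kappa> r) turns the final noise term into a multiple of
    \<epsilon>0 sqrt (\<sigma>r / \<kappa>); the 6 gives the exponent 36 / (4 * 2) = 9/2 times ln
    n.\<close>
  define \<tau> where "\<tau> = 6 * \<epsilon>0 * \<sigma>r / q"
  \<comment> \<open>The minimiser of \<open>\<theta>\<^sup>2 * W / p - \<theta> * \<tau>\<close>,
    with minimum \<open>- \<tau>\<^sup>2 * p / (4 * W)\<close>.\<close>
  define \<theta> where "\<theta> = \<tau> * p / (2 * W)"
  have \<sigma>0pos: "0 < \<sigma> 0" using \<sigma>0 \<sigma>r \<kappa> by simp
  have W: "0 < W" and K: "0 < K" using \<sigma>0pos \<beta> by (simp_all add: W_def K_def)
  have \<tau>: "0 < \<tau>" using \<epsilon>0 \<sigma>r q by (simp add: \<tau>_def)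
  have \<tau>_le: "\<tau> \<le> \<sigma>r / 16"
  proof -
    have "\<epsilon>0 / q \<le> 1 / 96" using \<epsilon>0(2) q(1) by (simp add: q_def field_simps)
    from mult_left_mono[OF this, of "6 * \<sigma>r"] \<sigma>r show ?thesis by (simp add: \<tau>_def mult_ac)
  qed
  have \<sigma>r_le: "\<sigma>r \<le> \<sigma> 0" using \<sigma>0 \<sigma>r \<kappa> by simp
  have \<theta>: "0 \<le> \<theta>" "\<theta> * K \<le> p"
  proof -
    show "0 \<le> \<theta>" using \<tau> p W by (simp add: \<theta>_def)
    have "\<theta> * K = p * (\<tau> / (4 * \<sigma> 0))"
      using \<sigma>0pos \<beta> by (simp add: \<theta>_def K_def W_def power2_eq_square)
    also have "\<dots> \<le> p * 1"
      using p \<tau>_le \<sigma>r_le \<sigma>0pos by (intro mult_left_mono) auto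
    finally show "\<theta> * K \<le> p" by simp
  qed
  have exponent: "\<theta>\<^sup>2 * W / p - \<theta> * \<tau> \<le> - (9 / 2) * ln (real n)"
  proof -
    have "\<theta>\<^sup>2 * W / p - \<theta> * \<tau> = - (\<tau>\<^sup>2 * p / (4 * W))"
      using p W by (simp add: \<theta>_def power2_eq_square field_simps)
    moreover have "\<tau>\<^sup>2 * p / (4 * W) = 9 / 2 * (\<epsilon>0\<^sup>2 * p / (\<kappa> ^ 3 * \<beta> * real r))"
    proof -
      have "\<tau>\<^sup>2 = 36 * \<epsilon>0\<^sup>2 * \<sigma>r\<^sup>2 / (\<kappa> * real r)"
        by (simp add: \<tau>_def power_divide power_mult_distrib q(2))
      moreover have "W = 2 * \<kappa>\<^sup>2 * \<sigma>r\<^sup>2 * \<beta>"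
        by (simp add: W_def \<sigma>0 power_mult_distrib)
      ultimately show ?thesis
        using \<sigma>r \<kappa> by (simp add: power2_eq_square power3_eq_cube mult_ac)
    qed
    moreover have "ln (real n) \<le> \<epsilon>0\<^sup>2 * p / (\<kappa> ^ 3 * \<beta> * real r)"
    proof -
      have "\<kappa> ^ 3 * \<beta> * real r * ln (real n) \<le> p * \<epsilon>0\<^sup>2"
        using p_ge' \<epsilon>0(1) by (simp add: pos_divide_le_eq)
      moreover have "0 < \<kappa> ^ 3 * \<beta> * real r" using \<kappa> \<beta> r0 by simp
      ultimately show ?thesis by (simp add: pos_le_divide_eq mult_ac)
    qed
    ultimately show ?thesis by linarith
  qed
  have K_bound: "\<And>t. t < n \<Longrightarrow> cmod (x t) \<le> K" and W_bound: "(\<Sum>t<n. (cmod (x t))\<^sup>2) \<le> W"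
    using incoherent_hankel_bounds[OF svd r less_imp_le[OF \<beta>] incohU[folded \<beta>_def] incohV[folded \<beta>_def] n_def n1 n2]
    unfolding K_def W_def by blast+
  define d where "d = 2 * \<tau> + 4 * \<alpha> * real n * K"
  have \<alpha>\<beta>: "32 * (\<alpha> * \<beta> * real n * \<kappa>) \<le> 1"
  proof -
    have "32 * cs * \<mu> * real r * \<kappa> = 32 * (\<beta> * real n) * \<kappa>" unfolding csr[symmetric] by simp
    with \<alpha>(2) have "\<alpha> \<le> 1 / (32 * (\<beta> * real n) * \<kappa>)" by (simp only:)
    moreover have "0 < 32 * (\<beta> * real n) * \<kappa>" using \<beta> n0 \<kappa> by simp
    ultimately have "\<alpha> * (32 * (\<beta> * real n) * \<kappa>) \<le> 1" by (simp only: pos_le_divide_eq)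
    then show ?thesis by (simp add: mult_ac)
  qed
  have d_le: "d \<le> \<sigma> 0 / 2"
  proof -
    \<comment> \<open>The bound on \<alpha> contributes \<sigma>r / 8, and so does 2 \<tau>;
      together d is at most \<sigma>r / 4.\<close>
    have "4 * \<alpha> * real n * K = 32 * (\<alpha> * \<beta> * real n * \<kappa>) * \<sigma>r / 8"
      by (simp add: K_def \<sigma>0)
    also have "\<dots> \<le> 1 * \<sigma>r / 8" using \<alpha>\<beta> \<sigma>r by (intro divide_right_mono mult_right_mono) auto
    finally show ?thesis using \<tau>_le \<sigma>r_le \<sigma>r unfolding d_def by linarith
  qed
  \<comment> \<open>Accounting of constants: the noise gives 4 * 2 * 6 = 48 against 7 * 12 = 84, the
    thresholding error 4 * 4 = 16 against 26.\<close>
  have final: "4 * sqrt (real r) * d / sqrt \<sigma>r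
      \<le> 26 * \<alpha> * cs * \<kappa> * \<mu> * real r * sqrt (real r) * sqrt \<sigma>r + 7 * 12 * \<epsilon>0 * sqrt (\<sigma>r / \<kappa>)"
  proof -
    have root: "\<sigma>r / sqrt \<sigma>r = sqrt \<sigma>r" using \<sigma>r by (simp add: real_div_sqrt)
    have "4 * sqrt (real r) * (2 * \<tau>) / sqrt \<sigma>r = 48 * \<epsilon>0 * (sqrt (real r) / q) * (\<sigma>r / sqrt \<sigma>r)"
      by (simp add: \<tau>_def)
    also have "\<dots> = 48 * \<epsilon>0 * sqrt (\<sigma>r / \<kappa>)"
      unfolding root using r0 by (simp add: q_def real_sqrt_mult real_sqrt_divide)
    also have "\<dots> \<le> 7 * 12 * \<epsilon>0 * sqrt (\<sigma>r / \<kappa>)"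
      using \<epsilon>0(1) \<sigma>r \<kappa> by (intro mult_right_mono) auto
    finally have noise: "4 * sqrt (real r) * (2 * \<tau>) / sqrt \<sigma>r \<le> 7 * 12 * \<epsilon>0 * sqrt (\<sigma>r / \<kappa>)" .
    have "4 * sqrt (real r) * (4 * \<alpha> * real n * K) / sqrt \<sigma>r
        = 16 * (\<alpha> * (\<beta> * real n) * \<kappa> * sqrt (real r)) * (\<sigma>r / sqrt \<sigma>r)"
      by (simp add: K_def \<sigma>0)
    also have "\<dots> = 16 * (\<alpha> * (\<beta> * real n) * \<kappa> * sqrt (real r) * sqrt \<sigma>r)"
      unfolding root by simp
    also have "\<dots> \<le> 26 * (\<alpha> * (\<beta> * real n) * \<kappa> * sqrt (real r) * sqrt \<sigma>r)"
      using \<alpha>(1) \<beta> \<kappa> \<sigma>r by (intro mult_right_mono) auto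
    also have "\<dots> = 26 * \<alpha> * cs * \<kappa> * \<mu> * real r * sqrt (real r) * sqrt \<sigma>r"
      unfolding csr[symmetric] by simp
    finally show ?thesis using noise unfolding d_def by (simp add: distrib_left add_divide_distrib)
  qed
  let ?P = "Pi_pmf {..<n} False (\<lambda>_. bernoulli_pmf p)"
  let ?N = "{b. \<forall>m<n. cmod (\<Sum>t<n. cnj (dft n t m) * (of_real ((if b t then 1 / p else 0) - 1) * x t)) \<le> 2 * \<tau>}"
  have "1 - 2 / (real n)\<^sup>2 \<le> 1 - 4 * real n * exp (\<theta>\<^sup>2 * W / p - \<theta> * \<tau>)"
    using failure_probability_le[OF True, of "exp (\<theta>\<^sup>2 * W / p - \<theta> * \<tau>)"] exponent by simp
  also have "\<dots> \<le> measure_pmf.prob ?P ?N"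
    by (rule bernoulli_transform_tail[OF p p1 K_bound W_bound \<theta>]) simp_all
  also have "\<dots> \<le> measure_pmf.prob ?P ((\<lambda>b. {i. b i}) -` ?Good)"
  proof (intro measure_pmf.finite_measure_mono subsetI vimageI2 CollectI impI allI)
    fix b w s0 U0 \<sigma>0 V0 L0 R0
    assume b: "b \<in> ?N"
      and sparse: "real (l0 n (PiOm {i. b i} s)) \<le> \<alpha> * p * real n"
      and hyp: "is_Gamma n (nat \<lfloor>\<alpha> * p * real n\<rfloor>) (Dinv n1 n2 (PiOm {i. b i} f)) w \<and>
            s0 = Dop n1 n2 w \<and>
            is_trunc_svd n1 n2 r
              (\<lambda>i j. Gop n1 n2 (\<lambda>k. PiOm {i. b i} f k - s0 k) i j / complex_of_real p) U0 \<sigma>0 V0 \<and>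
            is_proj_rowball n1 r (2 * \<mu> * real r * cs / real n * (spec_norm n1 r (half_factor U0 \<sigma>0))\<^sup>2)
              (half_factor U0 \<sigma>0) L0 \<and>
            is_proj_rowball n2 r (2 * \<mu> * real r * cs / real n * (spec_norm n2 r (half_factor V0 \<sigma>0))\<^sup>2)
              (half_factor V0 \<sigma>0) R0"
    have "op_le n1 n2 (\<lambda>i j. Gop n1 n2 (\<lambda>k. PiOm {i. b i} f k - Dop n1 n2 w k) i j / of_real p - hankel x i j) d"
      unfolding d_def f_def
    proof (rule initialization_perturbation[OF n_def n1 n2 p \<alpha>(1) less_imp_le[OF K] _ sparse K_bound])
      show "cmod (\<Sum>t<n. cnj (dft n t m) * (of_real ((if t \<in> {i. b i} then 1 / p else 0) - 1) * x t)) \<le> 2 * \<tau>"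
        if "m < n" for m
        using b that by simp
      show "is_Gamma n (nat \<lfloor>\<alpha> * p * real n\<rfloor>) (Dinv n1 n2 (PiOm {i. b i} (\<lambda>k. Dop n1 n2 x k + s k))) w"
        using hyp unfolding f_def by blast
    qed (use \<tau> in simp_all)
    moreover have "2 * \<mu> * real r * cs / real n = 2 * \<beta>" by (simp add: \<beta>_def)
    ultimately have "dist_factors n1 n2 r L0 R0 (half_factor U \<sigma>) (half_factor V \<sigma>)
        \<le> 4 * sqrt (real r) * d / sqrt (\<sigma> (r - 1))"
      using hyp
      by (intro initialization_distance[OF svd r _ _ d_le incohU[folded \<beta>_def] incohV[folded \<beta>_def]
            less_imp_le[OF \<beta>]]) auto
    also note final[unfolded \<sigma>r_def]
    finally show "dist_factors n1 n2 r L0 R0 (half_factor U \<sigma>) (half_factor V \<sigma>)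
        \<le> 26 * \<alpha> * cs * \<kappa> * \<mu> * real r * sqrt (real r) * sqrt \<sigma>r + 7 * 12 * \<epsilon>0 * sqrt (\<sigma>r / \<kappa>)"
      unfolding \<sigma>r_def .
  qed simp
  finally show ?thesis by (simp add: bernoulli_set_pmf_def)
qed

theorem theorem2:
  shows "\<exists>c0>0. \<forall>(n1::nat) (n2::nat) (r::nat) (x::cvec) (s::cvec)
            (Unat::cmat) (\<sigma>n::nat \<Rightarrow> real) (Vnat::cmat) (\<mu>::real) (\<alpha>::real) (p::real) (\<epsilon>0::real).
    let n = n1 + n2 - 1;
        cs = max (real n / real n1) (real n / real n2);
        \<kappa> = \<sigma>n 0 / \<sigma>n (r - 1);
        \<sigma>r = \<sigma>n (r - 1);
        z = Dop n1 n2 x;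
        f = (\<lambda>k. z k + s k);
        Lnat = half_factor Unat \<sigma>n;
        Rnat = half_factor Vnat \<sigma>n
    in
    (1 \<le> n1 \<and> 1 \<le> n2 \<and> 1 \<le> r \<and>
     is_compact_svd n1 n2 r (hankel x) Unat \<sigma>n Vnat \<and>
     norm2inf n1 r Unat \<le> sqrt (\<mu> * cs * real r / real n) \<and>
     norm2inf n2 r Vnat \<le> sqrt (\<mu> * cs * real r / real n) \<and>
     0 \<le> \<alpha> \<and> \<alpha> \<le> 1 / (32 * cs * \<mu> * real r * \<kappa>) \<and>
     p \<le> 1 \<and> p \<ge> (\<epsilon>0 powr (-2) * \<kappa> ^ 3 * cs * \<mu> * (real r) ^ 2 * ln (real n)) / real n \<and>
     0 < \<epsilon>0 \<and> \<epsilon>0 < sqrt (\<kappa> * real r) / (8 * c0))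
    \<longrightarrow>
    measure_pmf.prob (bernoulli_set_pmf n p)
      {\<Omega>. real (l0 n (PiOm \<Omega> s)) \<le> \<alpha> * p * real n \<longrightarrow>
         (\<forall>w s0 U0 \<sigma>0 V0 L0 R0.
            is_Gamma n (nat \<lfloor>\<alpha> * p * real n\<rfloor>) (Dinv n1 n2 (PiOm \<Omega> f)) w \<and>
            s0 = Dop n1 n2 w \<and>
            is_trunc_svd n1 n2 r
              (\<lambda>i j. Gop n1 n2 (\<lambda>k. PiOm \<Omega> f k - s0 k) i j / complex_of_real p) U0 \<sigma>0 V0 \<and>
            is_proj_rowball n1 r (2 * \<mu> * real r * cs / real n * (spec_norm n1 r (half_factor U0 \<sigma>0))\<^sup>2)
              (half_factor U0 \<sigma>0) L0 \<and>
            is_proj_rowball n2 r (2 * \<mu> * real r * cs / real n * (spec_norm n2 r (half_factor V0 \<sigma>0))\<^sup>2)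
              (half_factor V0 \<sigma>0) R0
          \<longrightarrow> dist_factors n1 n2 r L0 R0 Lnat Rnat
              \<le> 26 * \<alpha> * cs * \<kappa> * \<mu> * real r * sqrt (real r) * sqrt \<sigma>r + 7 * c0 * \<epsilon>0 * sqrt (\<sigma>r / \<kappa>))}
      \<ge> 1 - 2 / (real n)\<^sup>2"
  unfolding Let_def
  \<comment> \<open>The witness 12 acts twice: 7 * 12 dominates the factor 48 of the noise term, and
    \<epsilon>0 < sqrt (\<kappa> r) / 96 keeps \<tau> at most \<sigma>r / 16.\<close>
  by (intro exI[of _ 12] conjI allI impI, simp, elim conjE,
      rule initialization_probability[OF refl refl refl refl refl]) assumption+

end
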